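(* Let $n>0$, $\mathbf p\in\mathbb{R}^2$, and let $\Lambda\subseteq\mathbb{Z}^2$ be a reduced sublattice. Given the standard basis $(\mathbf b_1,\mathbf b_2)$ of $\Lambda$ and a real $x_{start}>0$, the vertex of $\mathrm{conv}(H_n\cap(\mathbf p+\Lambda))$ lying in $\{x\ge x_{start}\}$ with the smallest $x$-coordinate can be computed in $O(\log^2(n+\det\Lambda))$ arithmetic operations.
   Context: $H_n:=\{(x,y)\in\mathbb{R}_{\ge0}^2: xy\ge n\}$. A sublattice $\Lambda\subseteq\mathbb{Z}^2$ is reduced if both coordinate projections of $\Lambda$ equal $\mathbb{Z}$. The standard basis of $\Lambda$ is the basis $\mathbf b_1,\mathbf b_2=(0,(\mathbf b_2)_y)$ with $(\mathbf b_1)_x>0$, $(\mathbf b_2)_y>0$, $0\le(\mathbf b_1)_y<(\mathbf b_2)_y$. Arithmetic model: comparisons, $+,-,\times$, integer division and integer square root cost $O(1)$. *)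

theory Defs
  imports "HOL-Analysis.Analysis"
begin

definition pair_det :: "int \<times> int \<Rightarrow> int \<times> int \<Rightarrow> int" where
  "pair_det u v = fst u * snd v - snd u * fst v"

definition lattice_basis :: "(int \<times> int) set \<Rightarrow> int \<times> int \<Rightarrow> int \<times> int \<Rightarrow> bool" where
  "lattice_basis \<Lambda> u v \<longleftrightarrow>
     pair_det u v \<noteq> 0 \<and>
     \<Lambda> = {(i * fst u + j * fst v, i * snd u + j * snd v) | i j. True}"

definition sublattice :: "(int \<times> int) set \<Rightarrow> bool" where
  "sublattice \<Lambda> \<longleftrightarrow> (\<exists>u v. lattice_basis \<Lambda> u v)"

text \<open>The description below determines a unique number for every sublattice; see
  \<open>lattice_det_eq\<close>.\<close>

definition lattice_det :: "(int \<times> int) set \<Rightarrow> int" where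
  "lattice_det \<Lambda> = (THE d. \<exists>u v. lattice_basis \<Lambda> u v \<and> d = \<bar>pair_det u v\<bar>)"

definition reduced_lattice :: "(int \<times> int) set \<Rightarrow> bool" where
  "reduced_lattice \<Lambda> \<longleftrightarrow> fst ` \<Lambda> = UNIV \<and> snd ` \<Lambda> = UNIV"

definition standard_basis :: "(int \<times> int) set \<Rightarrow> int \<times> int \<Rightarrow> int \<times> int \<Rightarrow> bool" where
  "standard_basis \<Lambda> b1 b2 \<longleftrightarrow>
     lattice_basis \<Lambda> b1 b2 \<and> fst b2 = 0 \<and> 0 < fst b1 \<and> 0 < snd b2 \<and>
     0 \<le> snd b1 \<and> snd b1 < snd b2"

lemma lattice_basis_pair_det_dvd:
  assumes "lattice_basis \<Lambda> u v" and "lattice_basis \<Lambda> w z"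
  shows "pair_det u v dvd pair_det w z"
proof -
  have "w = (1 * fst w + 0 * fst z, 1 * snd w + 0 * snd z)"
    and "z = (0 * fst w + 1 * fst z, 0 * snd w + 1 * snd z)"
    by simp_all
  then have "w \<in> \<Lambda>" and "z \<in> \<Lambda>"
    using assms(2) unfolding lattice_basis_def by blast+
  then obtain i j k l where
    w: "w = (i * fst u + j * fst v, i * snd u + j * snd v)" and
    z: "z = (k * fst u + l * fst v, k * snd u + l * snd v)"
    using assms(1) unfolding lattice_basis_def by blast
  have "pair_det w z = pair_det u v * (i * l - j * k)"
    unfolding w z pair_det_def by (simp add: algebra_simps)
  then show ?thesis by simp
qed

lemma lattice_det_eq:
  assumes "lattice_basis \<Lambda> u v"
  shows "lattice_det \<Lambda> = \<bar>pair_det u v\<bar>"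
  unfolding lattice_det_def
proof (rule the_equality)
  show "\<exists>w z. lattice_basis \<Lambda> w z \<and> \<bar>pair_det u v\<bar> = \<bar>pair_det w z\<bar>"
    using assms by blast
next
  fix d assume "\<exists>w z. lattice_basis \<Lambda> w z \<and> d = \<bar>pair_det w z\<bar>"
  then show "d = \<bar>pair_det u v\<bar>"
    using assms lattice_basis_pair_det_dvd by (metis zdvd_antisym_abs)
qed

definition hyperbola_region :: "real \<Rightarrow> (real \<times> real) set" where
  "hyperbola_region n = {(x, y). 0 \<le> x \<and> 0 \<le> y \<and> n \<le> x * y}"

definition translate :: "real \<times> real \<Rightarrow> (int \<times> int) set \<Rightarrow> (real \<times> real) set" where
  "translate p \<Lambda> = (\<lambda>(i, j). p + (real_of_int i, real_of_int j)) ` \<Lambda>"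

definition hyperbola_hull :: "real \<Rightarrow> real \<times> real \<Rightarrow> (int \<times> int) set \<Rightarrow> (real \<times> real) set" where
  "hyperbola_hull n p \<Lambda> = convex hull (hyperbola_region n \<inter> translate p \<Lambda>)"

definition first_vertex_from ::
  "real \<Rightarrow> real \<times> real \<Rightarrow> (int \<times> int) set \<Rightarrow> real \<Rightarrow> real \<times> real \<Rightarrow> bool" where
  "first_vertex_from n p \<Lambda> x_start v \<longleftrightarrow>
     v extreme_point_of hyperbola_hull n p \<Lambda> \<and> x_start \<le> fst v \<and>
     (\<forall>w. w extreme_point_of hyperbola_hull n p \<Lambda> \<and> x_start \<le> fst w \<longrightarrow> fst v \<le> fst w)"

text \<open>
  Programs are finite while-programs over registers holding exact real numbers; the only
  literals are integers. Since the translation vector and the starting abscissa are real,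
  integer division and integer square root accept real operands: they return the floor of the
  exact quotient and of the exact square root. Division by zero yields \<open>0\<close>, and the
  square root is extended to negative operands as an odd function.
\<close>

datatype aexp =
    Lit int
  | Reg nat
  | Add aexp aexp
  | Sub aexp aexp
  | Mul aexp aexp
  | IDiv aexp aexp
  | ISqrt aexp

datatype bexp =
    Less aexp aexp
  | Eq aexp aexp
  | Neg bexp
  | Conj bexp bexp

datatype com =
    Skip
  | Assign nat aexp
  | Seq com com
  | Ite bexp com com
  | While bexp com

type_synonym state = "nat \<Rightarrow> real"

fun aval :: "aexp \<Rightarrow> state \<Rightarrow> real" where
  "aval (Lit k) s = of_int k"
| "aval (Reg r) s = s r"
| "aval (Add a b) s = aval a s + aval b s"
| "aval (Sub a b) s = aval a s - aval b s"
| "aval (Mul a b) s = aval a s * aval b s"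
| "aval (IDiv a b) s = of_int \<lfloor>aval a s / aval b s\<rfloor>"
| "aval (ISqrt a) s = of_int \<lfloor>sqrt (aval a s)\<rfloor>"

fun bval :: "bexp \<Rightarrow> state \<Rightarrow> bool" where
  "bval (Less a b) s \<longleftrightarrow> aval a s < aval b s"
| "bval (Eq a b) s \<longleftrightarrow> aval a s = aval b s"
| "bval (Neg b) s \<longleftrightarrow> \<not> bval b s"
| "bval (Conj b c) s \<longleftrightarrow> bval b s \<and> bval c s"

fun acost :: "aexp \<Rightarrow> nat" where
  "acost (Lit k) = 0"
| "acost (Reg r) = 0"
| "acost (Add a b) = acost a + acost b + 1"
| "acost (Sub a b) = acost a + acost b + 1"
| "acost (Mul a b) = acost a + acost b + 1"
| "acost (IDiv a b) = acost a + acost b + 1"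
| "acost (ISqrt a) = acost a + 1"

fun bcost :: "bexp \<Rightarrow> nat" where
  "bcost (Less a b) = acost a + acost b + 1"
| "bcost (Eq a b) = acost a + acost b + 1"
| "bcost (Neg b) = bcost b"
| "bcost (Conj b c) = bcost b + bcost c"

text \<open>\<open>exec c s t s'\<close>: started in \<open>s\<close>, the program \<open>c\<close> halts in \<open>s'\<close> after \<open>t\<close> operations. Each
  assignment is charged one unit on top of the operations in its right-hand side.\<close>

inductive exec :: "com \<Rightarrow> state \<Rightarrow> nat \<Rightarrow> state \<Rightarrow> bool" where
  Skip: "exec Skip s 0 s"
| Assign: "exec (Assign r a) s (acost a + 1) (s(r := aval a s))"
| Seq: "exec c s t s' \<Longrightarrow> exec d s' t' s'' \<Longrightarrow> exec (Seq c d) s (t + t') s''"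
| IfTrue: "bval b s \<Longrightarrow> exec c s t s' \<Longrightarrow> exec (Ite b c d) s (bcost b + t) s'"
| IfFalse: "\<not> bval b s \<Longrightarrow> exec d s t s' \<Longrightarrow> exec (Ite b c d) s (bcost b + t) s'"
| WhileFalse: "\<not> bval b s \<Longrightarrow> exec (While b c) s (bcost b) s"
| WhileTrue: "bval b s \<Longrightarrow> exec c s t s' \<Longrightarrow> exec (While b c) s' t' s'' \<Longrightarrow>
    exec (While b c) s (bcost b + t + t') s''"

definition input_state ::
  "real \<Rightarrow> real \<times> real \<Rightarrow> int \<times> int \<Rightarrow> int \<times> int \<Rightarrow> real \<Rightarrow> state" where
  "input_state n p b1 b2 x_start =
     (\<lambda>_. 0)(0 := n, 1 := fst p, 2 := snd p,
             3 := of_int (fst b1), 4 := of_int (snd b1),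
             5 := of_int (fst b2), 6 := of_int (snd b2), 7 := x_start)"

definition output_point :: "state \<Rightarrow> real \<times> real" where
  "output_point s = (s 0, s 1)"

end

theory Submission
  imports Defs
begin

text \<open>
  Let \<open>H\<close> be the hyperbola region. The algorithm keeps two lattice points \<open>L\<close>, \<open>R\<close> of \<open>H\<close> with
  \<open>x(L) < x_start \<le> x(R)\<close> and a lattice point \<open>Q\<close> below the line \<open>LR\<close> and outside \<open>H\<close> such that
  \<open>R - L\<close> and \<open>Q - L\<close> form a basis of the lattice. If the lattice line through \<open>Q\<close> parallel to \<open>LR\<close>
  misses \<open>H\<close>, then by convexity no lattice point of \<open>H\<close> lies below \<open>LR\<close>; hence \<open>LR\<close> spans the
  edge of the hull crossing the abscissa \<open>x_start\<close>, and the vertex sought is the last point of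
  \<open>H\<close> on the ray from \<open>L\<close> through \<open>R\<close>. Otherwise the points of \<open>H\<close> on that line all lie on one side
  of \<open>Q\<close>; the nearest one replaces \<open>R\<close> or \<open>L\<close>, its neighbour replaces \<open>Q\<close>, and the new end point slides
  on parallel to the segment from the other end point to \<open>Q\<close> as far as \<open>H\<close> permits. Entering and
  leaving points of lines are roots of quadratics, so each such round takes \<open>O(1)\<close> operations.
  The horizontal widths \<open>x(R) - x(L)\<close> of successive rounds grow like Fibonacci numbers.

  Beyond the abscissa \<open>n + d\<close>, where \<open>d\<close> is the determinant, the hull has at most one vertex, so
  \<open>x_start\<close> may be replaced by \<open>min x_start (n + d)\<close>. Since \<open>(d, 0)\<close> is a lattice vector, a width above
  \<open>n + d\<close> forces \<open>R\<close> into the bottom row, after which at most one further replacement is possible.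
  Hence there are \<open>O(log (n + d))\<close> rounds.
\<close>

subsection \<open>Loop-free programs\<close>

fun while_free :: "com \<Rightarrow> bool" where
  "while_free Skip = True"
| "while_free (Assign r a) = True"
| "while_free (Seq c d) = (while_free c \<and> while_free d)"
| "while_free (Ite b c d) = (while_free c \<and> while_free d)"
| "while_free (While b c) = False"

text \<open>The value on a loop is a dummy: \<open>run\<close> is only applied to programs
  satisfying \<open>while_free\<close>.\<close>

primrec run :: "com \<Rightarrow> state \<Rightarrow> state" where
  "run Skip s = s"
| "run (Assign r a) s = s(r := aval a s)"
| "run (Seq c d) s = run d (run c s)"
| "run (Ite b c d) s = (if bval b s then run c s else run d s)"
| "run (While b c) s = s"

text \<open>Both branches of a conditional are charged, so that the bound is independent of the
  state.\<close>

fun max_cost :: "com \<Rightarrow> nat" where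
  "max_cost Skip = 0"
| "max_cost (Assign r a) = acost a + 1"
| "max_cost (Seq c d) = max_cost c + max_cost d"
| "max_cost (Ite b c d) = bcost b + max_cost c + max_cost d"
| "max_cost (While b c) = 0"

lemma exec_while_free:
  assumes "while_free c"
  obtains t where "exec c s t (run c s)" "t \<le> max_cost c"
proof -
  have "while_free c \<Longrightarrow> \<exists>t\<le>max_cost c. exec c s t (run c s)"
  proof (induction c arbitrary: s)
    case Skip
    show ?case using exec.Skip[of s] by (intro exI[of _ 0]) simp
  next
    case (Assign r a)
    show ?case unfolding run.simps max_cost.simps using exec.Assign[of r a s] by blast
  next
    case (Seq c d)
    then obtain t where t: "exec c s t (run c s)" "t \<le> max_cost c"
      by fastforce
    from Seq obtain t' where t': "exec d (run c s) t' (run d (run c s))" "t' \<le> max_cost d"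
      by fastforce
    show ?case using exec.Seq[OF t(1) t'(1)] t(2) t'(2) by (intro exI[of _ "t + t'"]) simp
  next
    case (Ite b c d)
    then obtain t where t: "exec c s t (run c s)" "t \<le> max_cost c"
      by fastforce
    from Ite obtain t' where t': "exec d s t' (run d s)" "t' \<le> max_cost d"
      by fastforce
    show ?case
    proof (cases "bval b s")
      case True
      then show ?thesis using exec.IfTrue[OF True t(1)] t(2) by (intro exI[of _ "bcost b + t"]) simp
    next
      case False
      then show ?thesis using exec.IfFalse[OF False t'(1)] t'(2) by (intro exI[of _ "bcost b + t'"]) simp
    qed
  qed simp
  with assms that show ?thesis by blast
qed

text \<open>Unrolls a loop whose number of rounds \<open>N\<close> is known; the summand
  \<open>bcost b\<close> outside the product pays for the last, failing test.\<close>

lemma exec_While_iterate: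
  assumes "while_free c" and "\<And>i. i < N \<Longrightarrow> bval b ((run c ^^ i) s)"
    and "\<not> bval b ((run c ^^ N) s)"
  obtains t where "exec (While b c) s t ((run c ^^ N) s)"
    "t \<le> N * (bcost b + max_cost c) + bcost b"
proof -
  have "\<exists>t \<le> N * (bcost b + max_cost c) + bcost b. exec (While b c) s t ((run c ^^ N) s)"
    using assms(2,3)
  proof (induction N arbitrary: s)
    case 0
    then show ?case using exec.WhileFalse[of b s c] by auto
  next
    case (Suc N)
    have b: "bval b s" using Suc.prems(1)[of 0] by simp
    have "bval b ((run c ^^ i) (run c s))" if "i < N" for i
      using Suc.prems(1)[of "Suc i"] that by (simp add: funpow_Suc_right del: funpow.simps)
    moreover have "\<not> bval b ((run c ^^ N) (run c s))"
      using Suc.prems(2) by (simp add: funpow_Suc_right del: funpow.simps)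
    ultimately obtain t' where t': "t' \<le> N * (bcost b + max_cost c) + bcost b"
      "exec (While b c) (run c s) t' ((run c ^^ N) (run c s))"
      using Suc.IH[of "run c s"] by blast
    obtain t where t: "exec c s t (run c s)" "t \<le> max_cost c"
      using exec_while_free[OF assms(1)] .
    have "exec (While b c) s (bcost b + t + t') ((run c ^^ Suc N) s)"
      using exec.WhileTrue[OF b t(1) t'(2)] by (simp add: funpow_Suc_right del: funpow.simps)
    then show ?case using t(2) t'(1) by (intro exI[of _ "bcost b + t + t'"]) auto
  qed
  with that show ?thesis by blast
qed

subsection \<open>The hyperbola region and its intersection with lines\<close>

lemma mem_hyperbola_region:
  assumes "0 < n"
  shows "P \<in> hyperbola_region n \<longleftrightarrow> 0 < fst P \<and> 0 < snd P \<and> n \<le> fst P * snd P"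
proof -
  have "0 < x \<and> 0 < y" if "0 \<le> x" "0 \<le> y" "n \<le> x * y" for x y :: real
    using assms that by (metis less_le_trans mult_eq_0_iff order_less_irrefl order_le_imp_less_or_eq)
  then show ?thesis
    unfolding hyperbola_region_def case_prod_unfold mem_Collect_eq by (meson less_imp_le)
qed

text \<open>In the product of the coordinates of a convex combination the mixed term
  \<open>x * y' + x' * y\<close> is at least \<open>2 * n\<close>, by the inequality of arithmetic
  and geometric means.\<close>

lemma convex_hyperbola_region:
  assumes "0 < n"
  shows "convex (hyperbola_region n)"
proof (rule convexI)
  fix P P' and s t :: real
  assume P: "P \<in> hyperbola_region n" "P' \<in> hyperbola_region n"
    and st: "0 \<le> s" "0 \<le> t" "s + t = 1"
  obtain x y x' y' where e: "P = (x, y)" "P' = (x', y')" by fastforce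
  have pos: "0 < x" "0 < y" "n \<le> x * y" "0 < x'" "0 < y'" "n \<le> x' * y'"
    using P mem_hyperbola_region[OF assms] by (auto simp: e)
  have "n * n \<le> (x * y) * (x' * y')"
    using pos assms by (intro mult_mono) auto
  moreover have "4 * ((x * y) * (x' * y')) \<le> (x * y' + x' * y)\<^sup>2"
    using zero_le_power2[of "x * y' - x' * y"] by (simp add: power2_eq_square algebra_simps)
  ultimately have "(2 * n)\<^sup>2 \<le> (x * y' + x' * y)\<^sup>2"
    by (simp add: power2_eq_square)
  then have mid: "2 * n \<le> x * y' + x' * y"
    using pos by (intro power2_le_imp_le[of "2 * n"]) auto
  have "(s + t) * (s + t) * n = n" using st(3) by simp
  then have "n = s * s * n + s * t * (2 * n) + t * t * n"
    by (simp add: algebra_simps)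
  also have "\<dots> \<le> s * s * (x * y) + s * t * (x * y' + x' * y) + t * t * (x' * y')"
    using mid pos st by (intro add_mono mult_left_mono) auto
  also have "\<dots> = (s * x + t * x') * (s * y + t * y')"
    by (simp add: algebra_simps)
  finally have "n \<le> (s * x + t * x') * (s * y + t * y')" .
  then show "s *\<^sub>R P + t *\<^sub>R P' \<in> hyperbola_region n"
    using pos st unfolding hyperbola_region_def e by (auto intro!: add_nonneg_nonneg mult_nonneg_nonneg)
qed

text \<open>\<open>entry_index n P e\<close> is meant to be the integer \<open>j\<close> for which the sequence \<open>P + j e\<close> enters the region.
  On the line the condition is \<open>A t\<^sup>2 + B t + C \<ge> 0\<close>, and the entry point is the root with nonnegative
  derivative, \<open>(sqrt D - B) / (2 A)\<close>, for either sign of \<open>A\<close>. Rounding the square root moves it by less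
  than \<open>1/2\<close> because \<open>A\<close> is a nonzero integer.\<close>

definition entry_guess :: "real \<Rightarrow> real \<times> real \<Rightarrow> real \<times> real \<Rightarrow> int" where
  "entry_guess n P e =
     (if fst e * snd e = 0
      then \<lfloor>(n - fst P * snd P) / (fst P * snd e + snd P * fst e)\<rfloor>
      else \<lfloor>(of_int \<lfloor>sqrt ((fst P * snd e + snd P * fst e) * (fst P * snd e + snd P * fst e)
               - 4 * (fst e * snd e) * (fst P * snd P - n))\<rfloor>
             - (fst P * snd e + snd P * fst e)) / (2 * (fst e * snd e))\<rfloor>)"

definition entry_index :: "real \<Rightarrow> real \<times> real \<Rightarrow> real \<times> real \<Rightarrow> int" where
  "entry_index n P e =
     (let g = entry_guess n P e in
      if P + of_int g *\<^sub>R e \<in> hyperbola_region n then g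
      else if P + (of_int g + 1) *\<^sub>R e \<in> hyperbola_region n then g + 1
      else g + 2)"

text \<open>Completing the square turns the sign of the polynomial at \<open>s\<close> into a
  comparison of \<open>\<bar>2 * A * s + B\<bar>\<close> with \<open>sqrt D\<close>. Between
  \<open>t\<close> and \<open>j\<close> the linear term \<open>2 * A * s + B\<close> crosses
  \<open>sqrt D\<close>, upwards if \<open>A\<close> is positive and downwards if it is
  negative.\<close>

lemma quadratic_entry_root:
  fixes A B C t j :: real
  assumes "A \<noteq> 0" and neg: "A * t\<^sup>2 + B * t + C < 0" and nonneg: "0 \<le> A * j\<^sup>2 + B * j + C"
    and "t < j"
  defines "D \<equiv> B * B - 4 * A * C"
  shows "0 \<le> D" "t < (sqrt D - B) / (2 * A)" "(sqrt D - B) / (2 * A) \<le> j"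
proof -
  have sq: "(2 * A * s + B)\<^sup>2 = 4 * A * (A * s\<^sup>2 + B * s + C) + D" for s
    by (simp add: D_def power2_eq_square algebra_simps)
  consider "0 < A" | "A < 0" using assms(1) by linarith
  then have "0 \<le> D \<and> t < (sqrt D - B) / (2 * A) \<and> (sqrt D - B) / (2 * A) \<le> j"
  proof cases
    case 1
    have t: "(2 * A * t + B)\<^sup>2 < D"
      using sq[of t] neg 1 by (simp add: mult_less_0_iff)
    have j: "D \<le> (2 * A * j + B)\<^sup>2"
      using sq[of j] nonneg 1 by (simp add: zero_le_mult_iff)
    have D: "0 \<le> D" using t zero_le_power2[of "2 * A * t + B"] by linarith
    have t': "\<bar>2 * A * t + B\<bar> < sqrt D"
      using t by (metis real_sqrt_less_mono real_sqrt_abs)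
    have j': "sqrt D \<le> \<bar>2 * A * j + B\<bar>"
      using j by (metis real_sqrt_le_mono real_sqrt_abs)
    have "2 * A * t < 2 * A * j" using 1 assms(4) by simp
    then have "sqrt D \<le> 2 * A * j + B" "2 * A * t + B < sqrt D" using t' j' by linarith+
    then show ?thesis using 1 D by (simp add: field_simps)
  next
    case 2
    have t: "D < (2 * A * t + B)\<^sup>2"
      using sq[of t] neg 2 by (simp add: mult_neg_neg)
    have j: "(2 * A * j + B)\<^sup>2 \<le> D"
      using sq[of j] nonneg 2 by (simp add: mult_le_0_iff)
    have D: "0 \<le> D" using j zero_le_power2[of "2 * A * j + B"] by linarith
    have t': "sqrt D < \<bar>2 * A * t + B\<bar>"
      using t by (metis real_sqrt_less_mono real_sqrt_abs)
    have j': "\<bar>2 * A * j + B\<bar> \<le> sqrt D"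
      using j by (metis real_sqrt_le_mono real_sqrt_abs)
    have "2 * A * j < 2 * A * t" using 2 assms(4) by simp
    then have "sqrt D < 2 * A * t + B" "2 * A * j + B \<le> sqrt D" using t' j' by linarith+
    then show ?thesis using 2 D by (simp add: field_simps)
  qed
  then show "0 \<le> D" "t < (sqrt D - B) / (2 * A)" "(sqrt D - B) / (2 * A) \<le> j" by auto
qed

text \<open>The exact root lies above \<open>j - 1\<close> and not above \<open>j\<close>, so
  rounding leaves a guess among \<open>j - 2\<close>, \<open>j - 1\<close>, \<open>j\<close>, and
  two membership tests correct it. They cannot succeed too early: by convexity an earlier hit would
  put the point of index \<open>j - 1\<close> into the region.\<close>

lemma entry_index_eq:
  assumes "0 < n" and int: "fst e \<in> \<int>" "snd e \<in> \<int>"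
    and inside: "P + of_int j *\<^sub>R e \<in> hyperbola_region n"
    and outside: "P + (of_int j - 1) *\<^sub>R e \<notin> hyperbola_region n"
  shows "entry_index n P e = j"
proof -
  obtain x y ex ey where P: "P = (x, y)" and e: "e = (ex, ey)" by fastforce
  define A B C where "A = ex * ey" and "B = x * ey + y * ex" and "C = x * y - n"
  define F where "F t = A * t\<^sup>2 + B * t + C" for t
  have F: "F t = (x + t * ex) * (y + t * ey) - n" for t
    by (simp add: F_def A_def B_def C_def power2_eq_square algebra_simps)
  note mem = mem_hyperbola_region[OF assms(1)]
  have j: "0 < x + j * ex" "0 < y + j * ey" "0 \<le> F j"
    using inside by (auto simp: mem P e F)
  obtain t where t: "real_of_int j - 1 \<le> t" "t < j" "F t < 0"
  proof (cases "F (of_int j - 1) < 0")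
    case True
    then show ?thesis using that[of "of_int j - 1"] by simp
  next
    case False
    let ?x = "x + (of_int j - 1) * ex" and ?y = "y + (of_int j - 1) * ey"
    have "n \<le> ?x * ?y" using False by (simp add: F)
    moreover have "\<not> (0 < ?x \<and> 0 < ?y)"
      using outside calculation by (auto simp: mem P e)
    ultimately have neg: "?x < 0"
      using assms(1) zero_less_mult_iff[of ?x ?y] by linarith
    \<comment> \<open>The point of index \<open>j - 1\<close> lies on the opposite branch of the
      hyperbola. At \<open>t\<close> the line crosses the vertical axis, where \<open>F\<close>
      equals \<open>- n\<close>.\<close>
    define t where "t = of_int j - (x + j * ex) / ex"
    have "?x = x + j * ex - ex" by (simp add: algebra_simps)
    then have ex: "x + j * ex < ex" "0 < ex" using neg j by linarith+
    then have "0 < (x + j * ex) / ex" "(x + j * ex) / ex < 1" using j by auto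
    moreover have "x + t * ex = 0" using ex by (simp add: t_def field_simps)
    ultimately show ?thesis using that[of t] assms(1) by (simp add: F t_def)
  qed
  let ?g = "entry_guess n P e"
  have g: "?g \<le> j \<and> j \<le> ?g + 2"
  proof (cases "A = 0")
    case True
    have "F j - F t = B * (j - t)" using True by (simp add: F_def algebra_simps)
    moreover have "0 < F j - F t" using j t by linarith
    ultimately have B: "0 < B" using t(2) by (metis diff_gt_0_iff_gt zero_less_mult_pos2)
    have "- C / B \<le> j" using j(3) B True by (simp add: F_def field_simps)
    moreover have "t < - C / B" using t(3) B True by (simp add: F_def field_simps)
    moreover have "?g = \<lfloor>- C / B\<rfloor>"
      using True by (simp add: entry_guess_def P e A_def B_def C_def)
    ultimately show ?thesis using t(1) by linarith
  next
    case False
    define D where "D = B * B - 4 * A * C"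
    note root = quadratic_entry_root[OF False t(3)[unfolded F_def] j(3)[unfolded F_def] t(2),
        folded D_def]
    have "A \<in> \<int>" using int by (simp add: A_def e)
    then have A: "1 \<le> \<bar>A\<bar>" using False by (auto elim!: Ints_cases)
    have "\<bar>sqrt D - of_int \<lfloor>sqrt D\<rfloor>\<bar> < 1" by linarith
    then have "\<bar>sqrt D - of_int \<lfloor>sqrt D\<rfloor>\<bar> < \<bar>A\<bar>" using A by linarith
    then have "\<bar>(sqrt D - of_int \<lfloor>sqrt D\<rfloor>) / (2 * A)\<bar> < 1 / 2"
      using A by (simp add: abs_mult field_simps)
    moreover have "(sqrt D - of_int \<lfloor>sqrt D\<rfloor>) / (2 * A)
        = (sqrt D - B) / (2 * A) - (of_int \<lfloor>sqrt D\<rfloor> - B) / (2 * A)"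
      by (simp add: diff_divide_distrib)
    moreover have "?g = \<lfloor>(of_int \<lfloor>sqrt D\<rfloor> - B) / (2 * A)\<rfloor>"
      using False unfolding entry_guess_def P e A_def B_def C_def D_def by simp
    ultimately show ?thesis using root t(1) by linarith
  qed
  have before: "P + of_int i *\<^sub>R e \<notin> hyperbola_region n" if "i < j" for i
  proof
    assume i: "P + of_int i *\<^sub>R e \<in> hyperbola_region n"
    define r where "r = 1 / real_of_int (j - i)"
    have r: "0 \<le> r" "0 \<le> 1 - r" "r * real_of_int (j - i) = 1" using that by (auto simp: r_def)
    have "r *\<^sub>R (P + of_int i *\<^sub>R e) + (1 - r) *\<^sub>R (P + of_int j *\<^sub>R e)
        = P + (of_int j - r * real_of_int (j - i)) *\<^sub>R e"
      by (simp add: algebra_simps)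
    with convexD[OF convex_hyperbola_region[OF assms(1)] i inside r(1,2)] outside r(3)
    show False by simp
  qed
  have "?g = j \<or> ?g + 1 = j \<or> ?g + 2 = j" using g by linarith
  then show ?thesis
    using inside before[of "?g"] before[of "?g + 1"] unfolding entry_index_def Let_def by auto
qed

section \<open>Leaving the region along integer directions\<close>

lemma Ints_neg_le:
  fixes z :: real
  assumes "z \<in> \<int>" "z < 0"
  shows "z \<le> -1"
  using assms by (auto elim!: Ints_cases)

text \<open>For \<open>L\<close> to the left of \<open>R\<close>,
  \<open>cross (R - L) (P - L)\<close> is positive exactly when \<open>P\<close> lies above the line
  \<open>LR\<close>.\<close>

definition cross :: "real \<times> real \<Rightarrow> real \<times> real \<Rightarrow> real" where
  "cross u v = fst u * snd v - snd u * fst v"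

lemma hyperbola_region_mono:
  assumes "0 < n" "P \<in> hyperbola_region n" "fst P \<le> fst P'" "snd P \<le> snd P'"
  shows "P' \<in> hyperbola_region n"
proof -
  note mem = mem_hyperbola_region[OF assms(1)]
  have "fst P * snd P \<le> fst P' * snd P'"
    using assms(2-) by (intro mult_mono) (auto simp: mem)
  then show ?thesis using assms(2-) by (auto simp: mem)
qed

lemma leaving_hyperbola_region:
  assumes "0 < n" "P \<in> hyperbola_region n" "P' \<notin> hyperbola_region n"
  shows "fst (P' - P) < 0 \<or> snd (P' - P) < 0"
proof (rule ccontr)
  assume "\<not> ?thesis"
  then have "P' \<in> hyperbola_region n" using hyperbola_region_mono[OF assms(1,2)] by simp
  then show False using assms(3) by blast
qed

text \<open>A negative integer coordinate of \<open>e\<close> lowers that coordinate by at least one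
  per step, so the sequence must leave; \<open>k\<close> is the index before the first exit.\<close>

lemma last_inside_hyperbola_region:
  assumes "0 < n" and P: "P \<in> hyperbola_region n"
    and "fst e \<in> \<int>" "snd e \<in> \<int>" "fst e < 0 \<or> snd e < 0"
  obtains k :: int where "0 \<le> k" "P + of_int k *\<^sub>R e \<in> hyperbola_region n"
    "P + (of_int k + 1) *\<^sub>R e \<notin> hyperbola_region n"
proof -
  note mem = mem_hyperbola_region[OF assms(1)]
  let ?out = "\<lambda>k::nat. P + of_nat k *\<^sub>R e \<notin> hyperbola_region n"
  have drop: "\<exists>k::nat. x + of_nat k * z \<le> 0" if "z \<in> \<int>" "z < 0" for x z :: real
  proof -
    obtain k :: nat where "x \<le> of_nat k" using real_arch_simple by blast
    moreover have "z \<le> -1" using that by (rule Ints_neg_le)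
    then have "of_nat k * z \<le> of_nat k * (-1)" by (intro mult_left_mono) auto
    ultimately show ?thesis by (intro exI[of _ k]) simp
  qed
  have "\<exists>k. ?out k"
    using assms(5) drop[OF assms(3), of "fst P"] drop[OF assms(4), of "snd P"]
    by (auto simp: mem not_less)
  then have out: "?out (LEAST k. ?out k)" by (rule LeastI_ex)
  obtain k where k: "(LEAST k. ?out k) = Suc k"
    using out P by (cases "LEAST k. ?out k") auto
  have "\<not> ?out k" using not_less_Least[of k ?out] k by simp
  with out k that[of "int k"] show ?thesis by (simp add: algebra_simps)
qed

text \<open>An interval of \<open>m\<close> consecutive integers contains a multiple of \<open>m\<close>, so the triangle spanned
  by \<open>L\<close>, \<open>R\<close> and a lattice point \<open>m\<close> levels below them contains a lattice point of the first level.\<close>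

lemma convex_level_point:
  fixes q m j :: int
  assumes "convex C" "L \<in> C" "R \<in> C" and V: "L + of_int q *\<^sub>R (R - L) + of_int m *\<^sub>R (Q - L) \<in> C"
    and "1 \<le> m" "q \<le> m * j" "m * j \<le> q + m - 1"
  shows "Q + of_int j *\<^sub>R (R - L) \<in> C"
proof -
  \<comment> \<open>\<open>a\<close>, \<open>b\<close> and \<open>1 / m\<close> are the barycentric
    weights of the sought point with respect to \<open>L\<close>, \<open>R\<close> and the given
    point on level \<open>m\<close>.\<close>
  define b a where "b = of_int (m * j - q) / real_of_int m"
    and "a = of_int (q + m - 1 - m * j) / real_of_int m"
  have m: "0 < real_of_int m" using assms by simp
  have nonneg: "0 \<le> a" "0 \<le> b" "0 \<le> 1 / real_of_int m"
    using assms unfolding a_def b_def by (auto intro!: divide_nonneg_nonneg simp del: of_int_diff of_int_add of_int_mult)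
  have "a + b + 1 / of_int m = (of_int (q + m - 1 - m * j) + of_int (m * j - q) + 1) / of_int m"
    unfolding a_def b_def by (simp only: add_divide_distrib)
  also have "\<dots> = 1" using m by simp
  finally have sum: "a + b + 1 / of_int m = 1" .
  have q: "b + of_int q / of_int m = of_int j" using m by (simp add: b_def field_simps)
  have "a *\<^sub>R L + b *\<^sub>R R + (1 / of_int m) *\<^sub>R (L + of_int q *\<^sub>R (R - L) + of_int m *\<^sub>R (Q - L)) \<in> C"
  proof -
    let ?V = "L + of_int q *\<^sub>R (R - L) + of_int m *\<^sub>R (Q - L)"
    have "convex hull {L, R, ?V} \<subseteq> C"
      using assms(1-3) V by (intro hull_minimal) auto
    moreover have "a *\<^sub>R L + b *\<^sub>R R + (1 / of_int m) *\<^sub>R ?V \<in> convex hull {L, R, ?V}"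
      unfolding convex_hull_3 using sum nonneg by blast
    ultimately show ?thesis by blast
  qed
  also have "a *\<^sub>R L + b *\<^sub>R R + (1 / of_int m) *\<^sub>R (L + of_int q *\<^sub>R (R - L) + of_int m *\<^sub>R (Q - L))
      = (a + b + 1 / of_int m) *\<^sub>R L + (b + of_int q / of_int m) *\<^sub>R (R - L) + (Q - L)"
    using m by (simp add: scaleR_add_right scaleR_diff_right scaleR_add_left)
  also have "\<dots> = Q + of_int j *\<^sub>R (R - L)"
    unfolding sum q by simp
  finally show ?thesis .
qed

subsection \<open>Lattice points near the hyperbola\<close>

text \<open>The standard basis of a reduced lattice has the form \<open>(1, a)\<close>,
  \<open>(0, d)\<close>, so two integers describe the lattice.\<close>

locale hyperbola_lattice =
  fixes n :: real and p :: "real \<times> real" and a d :: int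
  assumes n_pos: "0 < n" and d_pos: "0 < d"
begin

abbreviation H :: "(real \<times> real) set" where "H \<equiv> hyperbola_region n"

definition grid :: "(real \<times> real) set" where
  "grid = {p + (of_int i, of_int (a * i + d * j)) | i j. True}"

lemmas mem_H = mem_hyperbola_region[OF n_pos]
lemmas convex_H = convex_hyperbola_region[OF n_pos]

section \<open>The translated lattice and coordinates in it\<close>

lemma gridE:
  assumes "P \<in> grid"
  obtains i j where "fst P = fst p + of_int i" "snd P = snd p + (of_int a * of_int i + of_int d * of_int j)"
proof -
  obtain i j where "P = p + (of_int i, of_int (a * i + d * j))"
    using assms unfolding grid_def by blast
  then show ?thesis by (intro that[of i j]) simp_all
qed

lemma gridI:
  assumes "fst P = fst p + of_int i" "snd P = snd p + (of_int a * of_int i + of_int d * of_int j)"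
  shows "P \<in> grid"
  unfolding grid_def mem_Collect_eq using assms
  by (intro exI[of _ i] exI[of _ j]) (auto simp: prod_eq_iff)

lemma grid_add_multiple:
  assumes "P \<in> grid" "P' \<in> grid" "P'' \<in> grid"
  shows "P + of_int k *\<^sub>R (P' - P'') \<in> grid"
proof -
  obtain i j where 1: "fst P = fst p + of_int i" "snd P = snd p + (of_int a * of_int i + of_int d * of_int j)"
    using assms(1) by (rule gridE)
  obtain i' j' where 2: "fst P' = fst p + of_int i'" "snd P' = snd p + (of_int a * of_int i' + of_int d * of_int j')"
    using assms(2) by (rule gridE)
  obtain i'' j'' where 3: "fst P'' = fst p + of_int i''" "snd P'' = snd p + (of_int a * of_int i'' + of_int d * of_int j'')"
    using assms(3) by (rule gridE)
  show ?thesis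
    by (rule gridI[of _ "i + k * (i' - i'')" "j + k * (j' - j'')"]) (simp_all add: 1 2 3 algebra_simps)
qed

lemma grid_add_diff:
  assumes "P \<in> grid" "P' \<in> grid" "P'' \<in> grid"
  shows "P + (P' - P'') \<in> grid"
  using grid_add_multiple[OF assms, of 1] by simp

lemma grid_diff_Ints:
  assumes "P \<in> grid" "P' \<in> grid"
  shows "fst (P - P') \<in> \<int>" "snd (P - P') \<in> \<int>"
  using assms by (auto elim!: gridE)

lemma grid_cross_dvd:
  assumes "P \<in> grid" "P' \<in> grid" "L \<in> grid"
  obtains m :: int where "cross (P - L) (P' - L) = of_int d * of_int m"
proof -
  obtain i j where 1: "fst P = fst p + of_int i" "snd P = snd p + (of_int a * of_int i + of_int d * of_int j)"
    using assms(1) by (rule gridE)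
  obtain i' j' where 2: "fst P' = fst p + of_int i'" "snd P' = snd p + (of_int a * of_int i' + of_int d * of_int j')"
    using assms(2) by (rule gridE)
  obtain i'' j'' where 3: "fst L = fst p + of_int i''" "snd L = snd p + (of_int a * of_int i'' + of_int d * of_int j'')"
    using assms(3) by (rule gridE)
  have "cross (P - L) (P' - L) = of_int d * of_int ((i - i'') * (j' - j'') - (i' - i'') * (j - j''))"
    by (simp add: cross_def 1 2 3 algebra_simps)
  then show ?thesis by (rule that)
qed

text \<open>\<open>(d, 0)\<close> is \<open>d\<close> times \<open>(1, a)\<close> minus
  \<open>a\<close> times \<open>(0, d)\<close>.\<close>

lemma grid_shift_x:
  assumes "P \<in> grid"
  shows "P + (of_int k * of_int d, 0) \<in> grid"
proof -
  obtain i j where 1: "fst P = fst p + of_int i" "snd P = snd p + (of_int a * of_int i + of_int d * of_int j)"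
    using assms by (rule gridE)
  show ?thesis by (rule gridI[of _ "i + k * d" "j - k * a"]) (simp_all add: 1 algebra_simps)
qed

lemma grid_shift_y:
  assumes "P \<in> grid"
  shows "P + (0, of_int k * of_int d) \<in> grid"
proof -
  obtain i j where 1: "fst P = fst p + of_int i" "snd P = snd p + (of_int a * of_int i + of_int d * of_int j)"
    using assms by (rule gridE)
  show ?thesis by (rule gridI[of _ i "j + k"]) (simp_all add: 1 algebra_simps)
qed

lemma grid_column:
  assumes "P \<in> grid" "P' \<in> grid" "fst P = fst P'"
  obtains m :: int where "snd P' = snd P + of_int m * of_int d"
proof -
  obtain i j where 1: "fst P = fst p + of_int i" "snd P = snd p + (of_int a * of_int i + of_int d * of_int j)"
    using assms(1) by (rule gridE)
  obtain i' j' where 2: "fst P' = fst p + of_int i'" "snd P' = snd p + (of_int a * of_int i' + of_int d * of_int j')"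
    using assms(2) by (rule gridE)
  have "i = i'" using 1 2 assms(3) by simp
  then have "snd P' = snd P + of_int (j' - j) * of_int d" by (simp add: 1 2 algebra_simps)
  then show ?thesis by (rule that)
qed

text \<open>Cramer's rule: the determinant of the pair is \<open>- d\<close> and the numerators are
  multiples of \<open>d\<close>, so the coordinates are integers. If \<open>L\<close> is left of
  \<open>R\<close>, \<open>m\<close> counts the lattice lines by which \<open>P\<close> lies below
  \<open>LR\<close>.\<close>

lemma grid_coordinates:
  assumes "L \<in> grid" "R \<in> grid" "Q \<in> grid" "P \<in> grid" and det: "cross (R - L) (Q - L) = - of_int d"
  obtains q m :: int where "P = L + of_int q *\<^sub>R (R - L) + of_int m *\<^sub>R (Q - L)"
    "cross (R - L) (P - L) = - of_int d * of_int m"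
proof -
  obtain m where m: "cross (P - L) (R - L) = of_int d * of_int m"
    using assms(1,2,4) by (metis grid_cross_dvd)
  obtain q where q: "cross (Q - L) (P - L) = of_int d * of_int q"
    using assms(1,3,4) by (metis grid_cross_dvd)
  have anti: "cross (R - L) (P - L) = - cross (P - L) (R - L)" by (simp add: cross_def)
  have d: "real_of_int d \<noteq> 0" using d_pos by simp
  have "of_int d * fst (P - L) = of_int d * (of_int q * fst (R - L) + of_int m * fst (Q - L))"
    "of_int d * snd (P - L) = of_int d * (of_int q * snd (R - L) + of_int m * snd (Q - L))"
  proof -
    have "cross (R - L) (Q - L) * fst (P - L)
        = cross (P - L) (Q - L) * fst (R - L) + cross (R - L) (P - L) * fst (Q - L)"
      "cross (R - L) (Q - L) * snd (P - L)
        = cross (P - L) (Q - L) * snd (R - L) + cross (R - L) (P - L) * snd (Q - L)"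
      by (simp_all add: cross_def algebra_simps)
    moreover have "cross (P - L) (Q - L) = - of_int d * of_int q"
      using q by (simp add: cross_def mult.commute)
    ultimately show "of_int d * fst (P - L) = of_int d * (of_int q * fst (R - L) + of_int m * fst (Q - L))"
      "of_int d * snd (P - L) = of_int d * (of_int q * snd (R - L) + of_int m * snd (Q - L))"
      using m det anti by (simp_all add: algebra_simps)
  qed
  then have "fst (P - L) = of_int q * fst (R - L) + of_int m * fst (Q - L)"
    "snd (P - L) = of_int q * snd (R - L) + of_int m * snd (Q - L)"
    using d by (simp_all only: mult_cancel_left simp_thms)
  then have "P - L = of_int q *\<^sub>R (R - L) + of_int m *\<^sub>R (Q - L)"
    by (simp add: prod_eq_iff)
  then show ?thesis using that[of q m] m anti by (simp add: algebra_simps)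
qed

section \<open>Wedges and their replacement steps\<close>

text \<open>The sign \<open>\<sigma>\<close> makes the predicate symmetric under exchanging \<open>L\<close> and \<open>R\<close>; \<open>W\<close> is the
  horizontal distance of the previous pair. The last conjunct records that the endpoint moved last
  cannot slide any further.\<close>

definition wedge :: "real \<Rightarrow> real \<times> real \<Rightarrow> real \<times> real \<Rightarrow> real \<times> real \<Rightarrow> real \<Rightarrow> bool" where
  "wedge \<sigma> L R Q W \<longleftrightarrow>
     L \<in> H \<inter> grid \<and> R \<in> H \<inter> grid \<and> Q \<in> grid - H \<and>
     cross (R - L) (Q - L) = - \<sigma> * of_int d \<and>
     0 \<le> \<sigma> * (fst Q - fst L) \<and> 0 \<le> \<sigma> * (fst R - fst Q) \<and>
     1 \<le> W \<and> W \<le> \<sigma> * (fst R - fst L) \<and>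
     (R + (Q - L) \<notin> H \<and> W \<le> \<sigma> * (fst R - fst Q) \<or>
      L + (Q - R) \<notin> H \<and> W \<le> \<sigma> * (fst Q - fst L))"

text \<open>Through this symmetry, steps need only be analysed for a moving
  \<open>R\<close>.\<close>

lemma wedge_swap:
  assumes "wedge \<sigma> L R Q W"
  shows "wedge (- \<sigma>) R L Q W"
proof -
  have "cross (L - R) (Q - R) = - cross (R - L) (Q - L)"
    by (simp add: cross_def algebra_simps)
  then show ?thesis using assms unfolding wedge_def by (auto simp: algebra_simps)
qed

text \<open>The new pair of difference vectors arises from the old one by unimodular shears, so the
  determinant persists. The width grows at least by the horizontal distance from \<open>L\<close> to
  \<open>Q'\<close>, which is at least the previous width \<open>W\<close>; this is the
  Fibonacci-type growth.\<close>

lemma wedge_step: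
  fixes j k :: int
  assumes w: "wedge \<sigma> L R Q W" and "1 \<le> j"
    and j: "Q + of_int j *\<^sub>R (R - L) \<in> H"
    and Q': "Q' = Q + (of_int j - 1) *\<^sub>R (R - L)" "Q' \<notin> H"
    and "0 \<le> k" and R': "R' = Q' + (R - L) + of_int k *\<^sub>R (Q' - L)" "R' \<in> H"
    and last: "R' + (Q' - L) \<notin> H"
  shows "wedge \<sigma> L R' Q' (\<sigma> * (fst R - fst L))"
    and "\<sigma> * (fst R - fst L) + W \<le> \<sigma> * (fst R' - fst L)"
proof -
  define u v where "u = \<sigma> * (fst R - fst L)" and "v = \<sigma> * (fst Q - fst L)"
  have v: "0 \<le> v" "v \<le> u" "1 \<le> W" "W \<le> u"
    using w by (auto simp: wedge_def u_def v_def algebra_simps)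
  have j1: "0 \<le> real_of_int j - 1" using assms(2) by simp
  have ju: "0 \<le> (of_int j - 1) * u" using j1 v by (intro mult_nonneg_nonneg) linarith+
  have kv: "0 \<le> of_int k * ((of_int j - 1) * u + v)" using ju v assms(6) by simp
  have Qx: "\<sigma> * (fst Q' - fst L) = (of_int j - 1) * u + v"
    by (simp add: Q' u_def v_def algebra_simps)
  have Rx: "\<sigma> * (fst R' - fst L) = u + ((of_int j - 1) * u + v) + of_int k * ((of_int j - 1) * u + v)"
    by (simp add: R' Q' u_def v_def algebra_simps)
  have RQ: "\<sigma> * (fst R' - fst Q') = u + of_int k * ((of_int j - 1) * u + v)"
    using Qx Rx by (simp add: algebra_simps)
  have grow: "W \<le> (of_int j - 1) * u + v"
  proof (cases "j = 1")
    case True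
    \<comment> \<open>For \<open>j = 1\<close> the point hit is \<open>R + (Q - L)\<close>. This
      excludes the first alternative in \<open>wedge\<close>, and the second one is the desired
      bound.\<close>
    then have "R + (Q - L) \<in> H" using j by (simp add: algebra_simps)
    then show ?thesis using w True by (auto simp: wedge_def u_def v_def)
  next
    case False
    then have "1 * u \<le> (of_int j - 1) * u" using assms(2) v by (intro mult_right_mono) auto
    then show ?thesis using v by linarith
  qed
  then show "\<sigma> * (fst R - fst L) + W \<le> \<sigma> * (fst R' - fst L)"
    using Rx kv by (simp add: u_def)
  have gQ: "Q' \<in> grid"
    using grid_add_multiple[of Q R L "j - 1"] w by (simp add: Q' wedge_def)
  then have "Q' + (R - L) \<in> grid"
    using grid_add_diff[of Q' R L] w by (simp add: wedge_def)
  then have gR: "R' \<in> grid"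
    using grid_add_multiple[of "Q' + (R - L)" Q' L k] gQ w by (simp add: R' wedge_def)
  have "cross (R' - L) (Q' - L) = cross (R - L) (Q - L)"
    unfolding R' Q' by (simp add: cross_def algebra_simps)
  then show "wedge \<sigma> L R' Q' (\<sigma> * (fst R - fst L))"
    using w gQ gR Q'(2) R'(2) last Qx Rx RQ v ju kv unfolding wedge_def u_def[symmetric] by auto
qed

text \<open>Take the first hit \<open>i\<close> on the ray from \<open>Q\<close>, which has positive
  index as \<open>Q\<close> is outside \<open>H\<close>. The slide along \<open>Q' - L\<close> ends
  because this vector leads from inside \<open>H\<close> to outside and so decreases a
  coordinate.\<close>

lemma wedge_jump_exists:
  assumes w: "wedge \<sigma> L R Q W" and j: "Q + of_int j *\<^sub>R (R - L) \<in> H" "1 \<le> j"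
  obtains i k :: int where "1 \<le> i" "Q + of_int i *\<^sub>R (R - L) \<in> H"
    "Q + (of_int i - 1) *\<^sub>R (R - L) \<notin> H" "0 \<le> k"
    "Q + of_int i *\<^sub>R (R - L) + of_int k *\<^sub>R (Q + (of_int i - 1) *\<^sub>R (R - L) - L) \<in> H"
    "Q + of_int i *\<^sub>R (R - L) + (of_int k + 1) *\<^sub>R (Q + (of_int i - 1) *\<^sub>R (R - L) - L) \<notin> H"
proof -
  let ?in = "\<lambda>i::nat. Q + of_nat i *\<^sub>R (R - L) \<in> H"
  have "?in (nat j)" using j by simp
  then have hit: "?in (LEAST i. ?in i)" by (rule LeastI)
  obtain i where i: "(LEAST i. ?in i) = Suc i"
    using hit w by (cases "LEAST i. ?in i") (auto simp: wedge_def)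
  have before: "\<not> ?in i" using not_less_Least[of i ?in] i by simp
  define Q' where "Q' = Q + of_nat i *\<^sub>R (R - L)"
  have g: "Q' \<in> grid" "L \<in> grid" "L \<in> H"
    using grid_add_multiple[of Q R L "int i"] w by (simp_all add: Q'_def wedge_def)
  have "fst (Q' - L) < 0 \<or> snd (Q' - L) < 0"
    using leaving_hyperbola_region[OF n_pos g(3) before[folded Q'_def]] .
  then obtain k :: int where k: "0 \<le> k" "Q + of_nat (Suc i) *\<^sub>R (R - L) + of_int k *\<^sub>R (Q' - L) \<in> H"
    "Q + of_nat (Suc i) *\<^sub>R (R - L) + (of_int k + 1) *\<^sub>R (Q' - L) \<notin> H"
    using last_inside_hyperbola_region[OF n_pos _ grid_diff_Ints[OF g(1,2)], of "Q + of_nat (Suc i) *\<^sub>R (R - L)"]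
      hit i by auto
  have 1: "real_of_int (int i + 1) = of_nat (Suc i)" "of_nat (Suc i) - 1 = real i" by auto
  show ?thesis
  proof (rule that[of "int i + 1" k])
    show "Q + of_int (int i + 1) *\<^sub>R (R - L) \<in> H" unfolding 1 using hit i by simp
    show "Q + (of_int (int i + 1) - 1) *\<^sub>R (R - L) \<notin> H" unfolding 1 using before .
  qed (use k in \<open>unfold 1 Q'_def, simp_all\<close>)
qed

text \<open>A width above \<open>n + d\<close> forces \<open>LR\<close> to descend and
  \<open>R\<close> to lie at height below 1. A point of \<open>H\<close> on the ray to the right of
  \<open>Q\<close> would lie at least one integer row below \<open>R\<close>, hence at negative
  height.\<close>

lemma wide_wedge_no_right:
  fixes j :: int
  assumes w: "wedge 1 L R Q W" and wide: "n + of_int d < fst R - fst L" and "1 \<le> j"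
  shows "Q + of_int j *\<^sub>R (R - L) \<notin> H"
proof
  assume V: "Q + of_int j *\<^sub>R (R - L) \<in> H"
  have mem: "L \<in> grid" "R \<in> grid" "Q \<in> grid" "L \<in> H" "R \<in> H" "Q \<notin> H"
    and det: "cross (R - L) (Q - L) = - of_int d"
    and x: "fst L \<le> fst Q" "fst Q \<le> fst R"
    using w by (auto simp: wedge_def)
  define u where "u = fst R - fst L"
  have u: "n + of_int d < u" "0 < u" using wide n_pos d_pos by (auto simp: u_def)
  \<comment> \<open>A point of \<open>H\<close> below \<open>LR\<close> and strictly between its
    ends would, by \<open>convex_level_point\<close>, force \<open>Q\<close> itself into
    \<open>H\<close>.\<close>
  have strip: False if P: "P \<in> grid" "P \<in> H" and below: "cross (R - L) (P - L) < 0"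
    and px: "fst L < fst P" "fst P < fst R" for P
  proof -
    obtain q m where qm: "P = L + of_int q *\<^sub>R (R - L) + of_int m *\<^sub>R (Q - L)"
      "cross (R - L) (P - L) = - of_int d * of_int m"
      using grid_coordinates[OF mem(1,2,3) P(1) det] .
    have m: "1 \<le> m" using below d_pos unfolding qm(2) by (simp add: zero_less_mult_iff)
    define v where "v = fst Q - fst L"
    have v: "0 \<le> v" "v \<le> u" using x by (auto simp: v_def u_def)
    have "fst P - fst L = of_int q * u + of_int m * v"
      by (subst qm(1)) (simp add: u_def v_def)
    then have px': "0 < of_int q * u + of_int m * v" "of_int q * u + of_int m * v < u"
      using px by (auto simp: u_def)
    have "q \<le> 0"
    proof (rule ccontr)
      assume "\<not> q \<le> 0"
      then have "1 * u \<le> of_int q * u" using u by (intro mult_right_mono) auto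
      moreover have "0 \<le> of_int m * v" using v m by simp
      ultimately show False using px' by linarith
    qed
    moreover have "- m + 1 \<le> q"
    proof (rule ccontr)
      assume "\<not> - m + 1 \<le> q"
      then have "of_int q * u \<le> of_int (- m) * u" using u by (intro mult_right_mono) auto
      moreover have "of_int m * v \<le> of_int m * u" using v m by (intro mult_left_mono) auto
      ultimately show False using px' by simp
    qed
    ultimately have "Q + of_int 0 *\<^sub>R (R - L) \<in> H"
      using convex_level_point[OF convex_H mem(4,5), of q m Q 0] P(2) m unfolding qm(1) by simp
    then show False using mem(6) by simp
  qed
  have Lx: "0 < fst L" "0 < snd R" "0 < snd L" using mem by (auto simp: mem_H)
  have slope: "snd R < snd L"
  proof (rule ccontr)
    assume nl: "\<not> snd R < snd L"
    show False
    proof (cases "snd R = snd L")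
      case True
      \<comment> \<open>At equal heights \<open>Q\<close> is at least one row lower, and the
        determinant would give \<open>u \<le> d\<close>.\<close>
      have "snd Q - snd L \<in> \<int>" using grid_diff_Ints[OF mem(3,1)] by simp
      moreover have "u * (snd Q - snd L) = - of_int d"
        using det True by (simp add: cross_def u_def)
      moreover from this have "snd Q - snd L \<noteq> 0" using d_pos by auto
      moreover have "snd Q - snd L < 0"
      proof (rule ccontr)
        assume "\<not> snd Q - snd L < 0"
        then have "0 \<le> u * (snd Q - snd L)" using u by simp
        then show False using calculation d_pos by simp
      qed
      ultimately have "snd Q - snd L \<le> -1" using Ints_neg_le by blast
      then have "u * (snd Q - snd L) \<le> u * (-1)" using u by (intro mult_left_mono) auto
      then show False using \<open>u * (snd Q - snd L) = - of_int d\<close> u n_pos by linarith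
    next
      case False
      \<comment> \<open>The shift by \<open>d\<close> keeps \<open>L\<close> in \<open>H\<close> and
        would lie below a rising segment \<open>LR\<close>, against \<open>strip\<close>.\<close>
      have "L + (of_int d, 0) \<in> grid" using grid_shift_x[OF mem(1), of 1] by simp
      moreover have "L + (of_int d, 0) \<in> H"
        using hyperbola_region_mono[OF n_pos mem(4)] d_pos by simp
      moreover have "cross (R - L) (L + (of_int d, 0) - L) < 0"
        using False nl d_pos by (simp add: cross_def)
      ultimately show False using strip[of "L + (of_int d, 0)"] d_pos u n_pos by (simp add: u_def)
    qed
  qed
  \<comment> \<open>At height at least 1 the point \<open>R - (d, 0)\<close> would still be in
    \<open>H\<close>, as its abscissa exceeds \<open>n\<close>; it lies below the descending
    \<open>LR\<close>, against \<open>strip\<close>.\<close>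
  have low: "snd R < 1"
  proof (rule ccontr)
    assume "\<not> snd R < 1"
    have "n \<le> (fst R - of_int d) * 1" using u Lx by (simp add: u_def)
    also have "\<dots> \<le> (fst R - of_int d) * snd R"
      using \<open>\<not> snd R < 1\<close> u Lx n_pos by (intro mult_left_mono) (auto simp: u_def)
    finally have "R + (- of_int d, 0) \<in> H" using u Lx n_pos by (auto simp: mem_H u_def)
    moreover have "R + (- of_int d, 0) \<in> grid" using grid_shift_x[OF mem(2), of "-1"] by simp
    moreover have "cross (R - L) (R + (- of_int d, 0) - L) = of_int d * (snd R - snd L)"
      by (simp add: cross_def algebra_simps)
    moreover have "of_int d * (snd R - snd L) < 0" using slope d_pos by (simp add: mult_pos_neg)
    ultimately show False using strip[of "R + (- of_int d, 0)"] d_pos u n_pos by (simp add: u_def)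
  qed
  have "u * (snd Q - snd L) = (snd R - snd L) * (fst Q - fst L) - of_int d"
    using det by (simp add: cross_def u_def)
  moreover have "(snd R - snd L) * (fst Q - fst L) \<le> 0" using slope x by (simp add: mult_nonpos_nonneg)
  ultimately have "u * (snd Q - snd L) < 0" using d_pos by simp
  then have wy: "snd Q - snd L < 0" using u by (simp add: mult_less_0_iff)
  have "(of_int j - 1) * (snd R - snd L) \<le> 0" using slope assms(3) by (simp add: mult_nonneg_nonpos)
  moreover define V where "V = Q + of_int j *\<^sub>R (R - L)"
  have "snd V - snd R = (snd Q - snd L) + (of_int j - 1) * (snd R - snd L)"
    by (simp add: V_def algebra_simps)
  ultimately have "snd V - snd R < 0" using wy by linarith
  moreover have "snd V - snd R \<in> \<int>"
    using grid_diff_Ints[OF grid_add_multiple[OF mem(3,2,1), of j] mem(2)] by (simp add: V_def)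
  ultimately have "snd V - snd R \<le> -1" using Ints_neg_le by blast
  then show False using V low by (simp add: mem_H V_def[symmetric])
qed

text \<open>A replacement of \<open>L\<close> would move it left by at least \<open>W\<close>, which
  exceeds its abscissa, and hence out of \<open>H\<close>.\<close>

lemma wide_wedge_stuck:
  fixes j :: int
  assumes w: "wedge 1 L R Q W" and wide: "n + of_int d < W" and L: "fst L \<le> n + of_int d" and "1 \<le> j"
  shows "Q + of_int j *\<^sub>R (R - L) \<notin> H" "Q + of_int j *\<^sub>R (L - R) \<notin> H"
proof -
  have W: "W \<le> fst R - fst L" using w by (simp add: wedge_def)
  then show "Q + of_int j *\<^sub>R (R - L) \<notin> H"
    using wide by (intro wide_wedge_no_right[OF w _ assms(4)]) linarith
  show "Q + of_int j *\<^sub>R (L - R) \<notin> H"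
  proof
    assume V: "Q + of_int j *\<^sub>R (L - R) \<in> H"
    obtain i k :: int where ik: "1 \<le> i" "Q + of_int i *\<^sub>R (L - R) \<in> H"
      "Q + (of_int i - 1) *\<^sub>R (L - R) \<notin> H" "0 \<le> k"
      "Q + of_int i *\<^sub>R (L - R) + of_int k *\<^sub>R (Q + (of_int i - 1) *\<^sub>R (L - R) - R) \<in> H"
      "Q + of_int i *\<^sub>R (L - R) + (of_int k + 1) *\<^sub>R (Q + (of_int i - 1) *\<^sub>R (L - R) - R) \<notin> H"
      using wedge_jump_exists[OF wedge_swap[OF w] V assms(4)] .
    define Q' where "Q' = Q + (of_int i - 1) *\<^sub>R (L - R)"
    define L' where "L' = Q' + (L - R) + of_int k *\<^sub>R (Q' - R)"
    have e: "Q + of_int i *\<^sub>R (L - R) = Q' + (L - R)" by (simp add: Q'_def algebra_simps)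
    have "L' \<in> H" using ik(5) unfolding e Q'_def[symmetric] L'_def .
    moreover have "L' + (Q' - R) \<notin> H"
      using ik(6) unfolding e Q'_def[symmetric] L'_def by (simp add: algebra_simps)
    ultimately have "- 1 * (fst L - fst R) + W \<le> - 1 * (fst L' - fst R)"
      using wedge_step(2)[OF wedge_swap[OF w] ik(1,2) Q'_def _ ik(4) L'_def] ik(3) by (simp add: Q'_def)
    moreover have "0 < fst L'" using \<open>L' \<in> H\<close> by (simp add: mem_H)
    ultimately show False using L wide by simp
  qed
qed

end

subsection \<open>Vertices of the hull\<close>

text \<open>The open half-space above the minimal level together with \<open>r\<close> is convex and
  contains \<open>S\<close>. Any segment in this set with \<open>r\<close> in its interior would
  have both ends on the minimal level.\<close>

lemma extreme_point_of_convex_hull_strict_min: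
  fixes c r :: "'a::euclidean_space"
  assumes "r \<in> S" and min: "\<And>P. P \<in> S \<Longrightarrow> P \<noteq> r \<Longrightarrow> c \<bullet> r < c \<bullet> P"
  shows "r extreme_point_of convex hull S"
proof -
  let ?T = "insert r {P. c \<bullet> r < c \<bullet> P}"
  have "convex ?T"
  proof (rule convexI)
    fix x y and s t :: real
    assume xy: "x \<in> ?T" "y \<in> ?T" and st: "0 \<le> s" "0 \<le> t" "s + t = 1"
    show "s *\<^sub>R x + t *\<^sub>R y \<in> ?T"
    proof (cases "x = r \<and> y = r \<or> s = 0 \<or> t = 0")
      case True
      then show ?thesis using xy st by (auto simp: scaleR_add_left[symmetric])
    next
      case False
      then have pos: "0 < s" "0 < t" using st by auto
      have "0 \<le> s * (c \<bullet> x - c \<bullet> r)" "0 \<le> t * (c \<bullet> y - c \<bullet> r)" using xy pos by auto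
      moreover have "0 < s * (c \<bullet> x - c \<bullet> r) \<or> 0 < t * (c \<bullet> y - c \<bullet> r)" using xy pos False by auto
      moreover have "c \<bullet> r = s * (c \<bullet> r) + t * (c \<bullet> r)" using st by (metis distrib_right mult_1)
      ultimately have "c \<bullet> r < s * (c \<bullet> x) + t * (c \<bullet> y)" by (auto simp: algebra_simps)
      then show ?thesis by (simp add: inner_add_right)
    qed
  qed
  then have sub: "convex hull S \<subseteq> ?T" using min by (intro hull_minimal) auto
  show ?thesis unfolding extreme_point_of_def
  proof (intro conjI ballI notI)
    show "r \<in> convex hull S" using assms(1) by (rule hull_inc)
    fix x y assume "x \<in> convex hull S" "y \<in> convex hull S" and seg: "r \<in> open_segment x y"
    then have xy: "x \<in> ?T" "y \<in> ?T" using sub by auto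
    obtain u where u: "x \<noteq> y" "0 < u" "u < 1" "r = (1 - u) *\<^sub>R x + u *\<^sub>R y"
      using seg by (auto simp: in_segment)
    have "c \<bullet> r = (1 - u) * (c \<bullet> x) + u * (c \<bullet> y)" by (subst u(4)) (simp add: inner_add_right)
    then have "(1 - u) * (c \<bullet> x - c \<bullet> r) + u * (c \<bullet> y - c \<bullet> r) = 0" by (simp add: algebra_simps)
    moreover have "0 \<le> (1 - u) * (c \<bullet> x - c \<bullet> r)" "0 \<le> u * (c \<bullet> y - c \<bullet> r)" using xy u by auto
    moreover have "0 < (1 - u) * (c \<bullet> x - c \<bullet> r) \<or> 0 < u * (c \<bullet> y - c \<bullet> r)" using xy u by auto
    ultimately show False by linarith
  qed
qed

context hyperbola_lattice
begin

abbreviation K :: "(real \<times> real) set" where "K \<equiv> convex hull (H \<inter> grid)"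

lemma extreme_mem: "v extreme_point_of K \<Longrightarrow> v \<in> H \<inter> grid"
  by (rule extreme_point_of_convex_hull)

text \<open>\<open>v\<close> lies strictly between \<open>w\<close> and \<open>v + (0, d)\<close>,
  which is again a lattice point of \<open>H\<close>.\<close>

lemma above_not_extreme:
  assumes "v \<in> H \<inter> grid" "w \<in> K" "fst w = fst v" "snd w < snd v"
  shows "\<not> v extreme_point_of K"
proof
  assume "v extreme_point_of K"
  have up: "v + (0, of_int d) \<in> K"
    using grid_shift_y[of v 1] hyperbola_region_mono[OF n_pos, of v] assms(1) d_pos
    by (intro hull_inc) simp
  define t where "t = (snd v - snd w) / (snd v + of_int d - snd w)"
  have den: "0 < snd v + of_int d - snd w" using assms(4) d_pos by simp
  have t: "0 < t" "t < 1" using assms(4) d_pos by (auto simp: t_def divide_less_eq)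
  have "t * (snd v + of_int d - snd w) = snd v - snd w" using den by (simp add: t_def)
  then have "v = (1 - t) *\<^sub>R w + t *\<^sub>R (v + (0, of_int d))"
    using assms(3) by (simp add: prod_eq_iff algebra_simps)
  moreover have "w \<noteq> v + (0, of_int d)" using assms(4) d_pos by (auto simp: prod_eq_iff)
  ultimately have "v \<in> open_segment w (v + (0, of_int d))" using t unfolding in_segment by blast
  then show False using \<open>v extreme_point_of K\<close> assms(2) up unfolding extreme_point_of_def by blast
qed

text \<open>Vertically below \<open>v\<close>, or at \<open>v\<close>, there is a point
  \<open>w\<close> of the open segment from \<open>L\<close> to \<open>E\<close>; either case
  prevents extremality.\<close>

lemma strip_not_extreme:
  assumes "L \<in> H \<inter> grid" "E \<in> H \<inter> grid" "v \<in> H \<inter> grid" "fst L < fst v" "fst v < fst E"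
    "0 \<le> cross (E - L) (v - L)"
  shows "\<not> v extreme_point_of K"
proof
  assume ext: "v extreme_point_of K"
  define t where "t = (fst v - fst L) / (fst E - fst L)"
  define w where "w = (1 - t) *\<^sub>R L + t *\<^sub>R E"
  have t: "0 < t" "t < 1" "t * (fst E - fst L) = fst v - fst L"
    using assms(4,5) by (auto simp: t_def divide_less_eq)
  have seg: "w \<in> open_segment L E"
    using t(1,2) assms(4,5) unfolding in_segment w_def by auto
  have K: "L \<in> K" "E \<in> K" using assms(1,2) by (auto intro: hull_inc)
  have "w \<in> K" using K t unfolding w_def by (intro convexD[OF convex_convex_hull]) auto
  have wx: "fst w = fst v" using t(3) by (simp add: w_def algebra_simps)
  have "(fst E - fst L) * (snd v - snd w)
      = (fst E - fst L) * (snd v - snd L) - (t * (fst E - fst L)) * (snd E - snd L)"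
    by (simp add: w_def algebra_simps)
  also have "\<dots> = cross (E - L) (v - L)" unfolding t(3) by (simp add: cross_def algebra_simps)
  finally have "0 \<le> snd v - snd w"
    using assms(4-6) by (smt (verit) mult_pos_neg)
  moreover have "\<not> snd w < snd v" using above_not_extreme[OF assms(3) \<open>w \<in> K\<close> wx] ext by blast
  ultimately have "v = w" using wx by (simp add: prod_eq_iff)
  then show False using seg ext K unfolding extreme_point_of_def by blast
qed

text \<open>A point of \<open>H\<close> below \<open>LR\<close> would yield one on the first lattice
  line below, the line through \<open>Q\<close>, which misses \<open>H\<close> by
  assumption.\<close>

lemma wedge_supporting:
  assumes w: "wedge 1 L R Q W"
    and right: "\<And>j::int. 1 \<le> j \<Longrightarrow> Q + of_int j *\<^sub>R (R - L) \<notin> H"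
    and left: "\<And>j::int. 1 \<le> j \<Longrightarrow> Q + of_int j *\<^sub>R (L - R) \<notin> H"
    and P: "P \<in> H \<inter> grid"
  shows "0 \<le> cross (R - L) (P - L)"
proof (rule ccontr)
  assume neg: "\<not> 0 \<le> cross (R - L) (P - L)"
  have mem: "L \<in> grid" "R \<in> grid" "Q \<in> grid" "L \<in> H" "R \<in> H" "Q \<notin> H" "P \<in> grid" "P \<in> H"
    and det: "cross (R - L) (Q - L) = - of_int d"
    using w P by (auto simp: wedge_def)
  obtain q m where qm: "P = L + of_int q *\<^sub>R (R - L) + of_int m *\<^sub>R (Q - L)"
    "cross (R - L) (P - L) = - of_int d * of_int m"
    using grid_coordinates[OF mem(1,2,3,7) det] .
  have m: "1 \<le> m" using neg d_pos unfolding qm(2) by (simp add: zero_less_mult_iff mult_le_0_iff not_le)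
  \<comment> \<open>This is \<open>q / m\<close> rounded up, so that \<open>m * j\<close> is the
    multiple of \<open>m\<close> among the integers from \<open>q\<close> to
    \<open>q + m - 1\<close>.\<close>
  define j where "j = (q + m - 1) div m"
  have "m * j \<le> q + m - 1" "q \<le> m * j"
    using m mult_div_mod_eq[of m "q + m - 1"] pos_mod_bound[of m "q + m - 1"] pos_mod_sign[of m "q + m - 1"]
    unfolding j_def by linarith+
  then have in_H: "Q + of_int j *\<^sub>R (R - L) \<in> H"
    using convex_level_point[OF convex_H mem(4,5), of q m Q j] mem(8) m unfolding qm(1) by simp
  consider "1 \<le> j" | "j = 0" | "1 \<le> - j" by linarith
  then show False
  proof cases
    case 3
    have "Q + of_int (- j) *\<^sub>R (L - R) = Q + of_int j *\<^sub>R (R - L)" by (simp add: algebra_simps)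
    then show ?thesis using left[OF 3] in_H by simp
  qed (use right in_H mem(6) in auto)
qed

section \<open>The first vertex from a given abscissa\<close>

definition first_vertex :: "real \<Rightarrow> real \<times> real \<Rightarrow> bool" where
  "first_vertex x v \<longleftrightarrow> v extreme_point_of K \<and> x \<le> fst v \<and>
     (\<forall>w. w extreme_point_of K \<and> x \<le> fst w \<longrightarrow> fst v \<le> fst w)"

lemma first_vertexD:
  assumes "first_vertex x v"
  shows "v extreme_point_of K" "x \<le> fst v" "w extreme_point_of K \<Longrightarrow> x \<le> fst w \<Longrightarrow> fst v \<le> fst w"
  using assms unfolding first_vertex_def by blast+

text \<open>Let \<open>r\<close> be the last point of \<open>H\<close> on the ray. It is extreme, so
  \<open>v\<close> is not to the right of it. Nor is \<open>v\<close> to the left, as it would lie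
  on or above the segment from \<open>L\<close> to \<open>r\<close>. In the column of
  \<open>r\<close> only \<open>r\<close> is extreme.\<close>

lemma first_vertex_on_edge:
  assumes w: "wedge 1 L R Q W" and x: "fst L < x" "x \<le> fst R"
    and supp: "\<And>P. P \<in> H \<inter> grid \<Longrightarrow> 0 \<le> cross (R - L) (P - L)"
    and v: "first_vertex x v"
  obtains k :: int where "0 \<le> k" "R + of_int k *\<^sub>R (R - L) \<in> H"
    "R + (of_int k + 1) *\<^sub>R (R - L) \<notin> H" "v = R + of_int k *\<^sub>R (R - L)"
proof -
  have mem: "L \<in> grid" "R \<in> grid" "Q \<in> grid" "L \<in> H" "R \<in> H" "Q \<notin> H"
    and det: "cross (R - L) (Q - L) = - of_int d"
    using w by (auto simp: wedge_def)
  define ux uy where "ux = fst R - fst L" and "uy = snd R - snd L"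
  have ux: "1 \<le> ux" using w by (auto simp: wedge_def ux_def)
  have ext: "v extreme_point_of K" and vx: "fst L < fst v" and vS: "v \<in> H \<inter> grid"
    using first_vertexD(1,2)[OF v] x extreme_mem by auto
  have E: "R + of_int k *\<^sub>R (R - L) \<in> grid" for k :: int
    using grid_add_multiple[OF mem(2,2,1)] .
  have cr: "cross (R + of_int k *\<^sub>R (R - L) - L) (v - L) = (1 + of_int k) * cross (R - L) (v - L)"
    for k :: int by (simp add: cross_def algebra_simps)
  show ?thesis
  proof (cases "uy < 0")
    case False
    \<comment> \<open>If \<open>LR\<close> does not descend, its ray stays in \<open>H\<close> for
      ever, so some lattice point \<open>E\<close> on it lies beyond \<open>v\<close> and
      \<open>v\<close> cannot be extreme.\<close>
    obtain k :: nat where k: "fst v - fst R < of_nat k" using reals_Archimedean2 by blast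
    have "of_nat k * 1 \<le> of_nat k * ux" using ux by (intro mult_left_mono) auto
    then have "fst v < fst (R + of_int (int k) *\<^sub>R (R - L))" using k by (simp add: ux_def)
    moreover have "R + of_int (int k) *\<^sub>R (R - L) \<in> H"
      using False ux by (intro hyperbola_region_mono[OF n_pos mem(5)]) (auto simp: ux_def uy_def)
    moreover have "0 \<le> (1 + of_int (int k)) * cross (R - L) (v - L)" using supp[OF vS] by simp
    ultimately have "\<not> v extreme_point_of K"
      using mem(1,4) vS vx E[of "int k"] cr[of "int k"]
      by (intro strip_not_extreme[of L "R + of_int (int k) *\<^sub>R (R - L)"]) auto
    then show ?thesis using ext by blast
  next
    case True
    have ne: "fst (R - L) < 0 \<or> snd (R - L) < 0" using True by (simp add: uy_def)
    obtain k where k: "0 \<le> k" "R + of_int k *\<^sub>R (R - L) \<in> H" "R + (of_int k + 1) *\<^sub>R (R - L) \<notin> H"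
      using last_inside_hyperbola_region[OF n_pos mem(5) grid_diff_Ints[OF mem(2,1)] ne] .
    define r where "r = R + of_int k *\<^sub>R (R - L)"
    have r: "r \<in> H \<inter> grid" using k(2) E by (simp add: r_def)
    have rx: "fst r = fst L + (of_int k + 1) * ux" "snd r = snd L + (of_int k + 1) * uy"
      by (simp_all add: r_def ux_def uy_def algebra_simps)
    have cross_r: "cross (R - L) (r - L) = 0" by (simp add: cross_def rx ux_def uy_def)
    have k1: "1 \<le> real_of_int k + 1" using k(1) by simp
    have "1 * ux \<le> (of_int k + 1) * ux" using k1 ux by (intro mult_right_mono) auto
    moreover have "fst R = fst L + ux" by (simp add: ux_def)
    ultimately have Rr: "fst R \<le> fst r" "fst L < fst r" using ux rx(1) by linarith+
    \<comment> \<open>Tilting the supporting line slightly about \<open>r\<close> makes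
      \<open>r\<close> the unique minimum. On the line itself, \<open>r\<close> is the rightmost
      lattice point of \<open>H\<close>. Off it, the cross product is at least 1, and positivity of
      \<open>snd P\<close> bounds the abscissa.\<close>
    have key: "fst P < fst r + (1 + ux * snd L) / (- uy) * cross (R - L) (P - L)"
      if P: "P \<in> H \<inter> grid" "P \<noteq> r" for P
    proof -
      obtain q m where qm: "P = L + of_int q *\<^sub>R (R - L) + of_int m *\<^sub>R (Q - L)"
        "cross (R - L) (P - L) = - of_int d * of_int m"
        using grid_coordinates[OF mem(1,2,3) _ det] P(1) by blast
      show ?thesis
      proof (cases "m = 0")
        case True
        have "q < k + 1"
        proof (rule ccontr)
          assume "\<not> q < k + 1"
          moreover have "q \<noteq> k + 1"
            using P(2) True qm(1) by (auto simp: r_def algebra_simps)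
          ultimately have q: "k + 2 \<le> q" by simp
          \<comment> \<open>If \<open>P\<close> were beyond \<open>r\<close>, convexity would put
            the next point \<open>L + (k + 2) (R - L)\<close> of the progression into
            \<open>H\<close>.\<close>
          define t where "t = (of_int k + 2) / real_of_int q"
          have t: "0 \<le> t" "0 \<le> 1 - t" "t * of_int q = of_int k + 2" using q k(1) by (auto simp: t_def)
          have "(1 - t) *\<^sub>R L + t *\<^sub>R P \<in> H"
            using t P(1) mem(4) by (intro convexD[OF convex_H]) auto
          also have "(1 - t) *\<^sub>R L + t *\<^sub>R P = L + (t * of_int q) *\<^sub>R (R - L)"
            using True by (subst qm(1)) (simp add: scaleR_add_right scaleR_diff_left)
          also have "\<dots> = R + (of_int k + 1) *\<^sub>R (R - L)" unfolding t(3) by (simp add: prod_eq_iff algebra_simps)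
          finally show False using k(3) by blast
        qed
        then have "of_int q * ux < (of_int k + 1) * ux" using ux by (intro mult_strict_right_mono) linarith+
        moreover have "fst P = fst L + of_int q * ux" using True by (subst qm(1)) (simp add: ux_def)
        ultimately show ?thesis using True qm(2) by (simp add: rx)
      next
        case False
        define c where "c = cross (R - L) (P - L)"
        have "0 \<le> c" using supp[OF P(1)] by (simp add: c_def)
        moreover have "c = of_int (- d * m)" using qm(2) by (simp add: c_def)
        moreover have "- d * m \<noteq> 0" using False d_pos by simp
        ultimately have c: "1 \<le> c" by linarith
        have y: "0 < snd P" "0 < snd L" using P(1) mem by (auto simp: mem_H)
        have "(- uy) * (fst P - fst L) = c - ux * (snd P - snd L)"
          by (simp add: c_def cross_def ux_def uy_def algebra_simps)
        also have "\<dots> < c + ux * snd L" using ux y by (simp add: algebra_simps)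
        also have "\<dots> \<le> c * (1 + ux * snd L)"
          using c ux y mult_right_mono[of 1 c "ux * snd L"] by (simp add: algebra_simps)
        finally have "fst P - fst L < c * (1 + ux * snd L) / (- uy)"
          using True by (simp add: field_simps)
        then show ?thesis using Rr(2) by (simp add: c_def mult.commute)
      qed
    qed
    define M where "M = (1 + ux * snd L) / (- uy)"
    have "r extreme_point_of K"
    proof (rule extreme_point_of_convex_hull_strict_min[where c = "(- M * uy - 1, M * ux)"])
      show "r \<in> H \<inter> grid" by (rule r)
      fix P assume P: "P \<in> H \<inter> grid" "P \<noteq> r"
      have f: "(- M * uy - 1, M * ux) \<bullet> X = M * cross (R - L) (X - L) - fst X + M * (ux * snd L - uy * fst L)" for X
        by (cases X) (simp add: cross_def ux_def uy_def algebra_simps)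
      show "(- M * uy - 1, M * ux) \<bullet> r < (- M * uy - 1, M * ux) \<bullet> P"
        using key[OF P] unfolding f cross_r M_def[symmetric] by simp
    qed
    then have "fst v \<le> fst r" using first_vertexD(3)[OF v] x Rr by simp
    moreover have "\<not> fst v < fst r"
      using strip_not_extreme[of L r v] mem(1,4) r vS vx ext supp[OF vS] cr[of k] k1 by (auto simp: r_def)
    ultimately have eq: "fst r = fst v" by simp
    have "cross (R - L) (v - L) = ux * (snd v - snd r) + cross (R - L) (r - L)"
      using eq by (simp add: cross_def ux_def algebra_simps)
    then have "0 \<le> ux * (snd v - snd r)" using supp[OF vS] cross_r by simp
    then have "snd r \<le> snd v" using ux by (simp add: zero_le_mult_iff)
    moreover have "\<not> snd r < snd v" using above_not_extreme[OF vS hull_inc[OF r] eq] ext by blast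
    ultimately have "v = r" using eq by (simp add: prod_eq_iff)
    then show ?thesis using that[OF k] by (simp add: r_def)
  qed
qed

text \<open>No column of positive abscissa lies to the left of \<open>R\<close>, and
  \<open>R\<close> is the lowest point of \<open>H\<close> in its own. A steep linear functional is
  therefore minimal exactly at \<open>R\<close>.\<close>

lemma first_vertex_in_first_column:
  assumes R: "R \<in> H \<inter> grid" "fst R \<le> 1" "R - (0, of_int d) \<notin> H"
    and x: "x \<le> fst R" and v: "first_vertex x v"
  shows "v = R"
proof -
  have col: "fst R \<le> fst P" "fst P \<noteq> fst R \<Longrightarrow> fst R + 1 \<le> fst P"
    "fst P = fst R \<Longrightarrow> P \<noteq> R \<Longrightarrow> snd R < snd P" if P: "P \<in> H \<inter> grid" for P
  proof -
    have pos: "0 < fst P" using P by (simp add: mem_H)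
    obtain i where i: "fst P - fst R = of_int i"
      using grid_diff_Ints(1)[of P R] P R by (auto elim: Ints_cases)
    have "- 1 < real_of_int i" using pos R(2) i by linarith
    then have i0: "0 \<le> i" by simp
    then show "fst R \<le> fst P" using i by simp
    show "fst R + 1 \<le> fst P" if "fst P \<noteq> fst R"
    proof -
      have "1 \<le> i" using that i i0 by (cases "i = 0") auto
      then show ?thesis using i by simp
    qed
    assume eq: "fst P = fst R" "P \<noteq> R"
    obtain m where m: "snd P = snd R + of_int m * of_int d"
      using grid_column[of R P] P R eq by auto
    have "0 < m"
    proof (rule ccontr)
      assume "\<not> 0 < m"
      moreover have "m \<noteq> 0" using eq m by (auto simp: prod_eq_iff)
      ultimately have "m \<le> -1" by simp
      then have "of_int m * of_int d \<le> (-1) * real_of_int d" using d_pos by (intro mult_right_mono) auto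
      then have "R - (0, of_int d) \<in> H"
        using m eq P by (intro hyperbola_region_mono[OF n_pos, of P "R - (0, of_int d)"]) simp_all
      then show False using R(3) by blast
    qed
    then show "snd R < snd P" using m d_pos by simp
  qed
  have "R extreme_point_of K"
  \<comment> \<open>One column to the right costs at least \<open>snd R + 1\<close>, more than the
    height that can be lost.\<close>
  proof (rule extreme_point_of_convex_hull_strict_min[where c = "(snd R + 1, 1)"])
    fix P assume P: "P \<in> H \<inter> grid" "P \<noteq> R"
    show "(snd R + 1, 1) \<bullet> R < (snd R + 1, 1) \<bullet> P"
    proof (cases "fst P = fst R")
      case True
      then show ?thesis using col(3)[OF P(1)] P(2) by (cases P; cases R) simp
    next
      case False
      have y: "0 < snd P" "0 < snd R" using P R by (auto simp: mem_H)
      have "(snd R + 1) * (fst R + 1) \<le> (snd R + 1) * fst P"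
        using col(2)[OF P(1) False] y by (intro mult_left_mono) auto
      then show ?thesis using y by (cases P; cases R) (simp add: algebra_simps)
    qed
  qed (rule R)
  then have "fst v \<le> fst R" and ext: "v extreme_point_of K"
    using first_vertexD[OF v] x by blast+
  moreover have vS: "v \<in> H \<inter> grid" using ext by (rule extreme_mem)
  ultimately have "fst v = fst R" using col(1)[OF vS] by simp
  then show ?thesis
    using col(3)[OF vS] above_not_extreme[OF vS hull_inc[OF R(1)]] ext by auto
qed

text \<open>Far to the right only the leftmost point of the bottom row can be extreme: any other lattice
  point there is the midpoint of two horizontal translates.\<close>

lemma extreme_far_right_unique:
  assumes v: "v extreme_point_of K" "n + of_int d \<le> fst v"
    and w: "w extreme_point_of K" "n + of_int d \<le> fst w"
  shows "v = w"
proof -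
  have midpoint: False if "y extreme_point_of K" "y + (h, 0) \<in> H \<inter> grid" "y - (h, 0) \<in> H \<inter> grid" "h \<noteq> 0"
    for y and h :: real
  proof -
    have "y = (1 - 1/2) *\<^sub>R (y + (h, 0)) + (1/2) *\<^sub>R (y - (h, 0))" by (simp add: prod_eq_iff field_simps)
    moreover have "y + (h, 0) \<noteq> y - (h, 0)" using that(4) by (auto simp: prod_eq_iff)
    ultimately have "y \<in> open_segment (y + (h, 0)) (y - (h, 0))"
      unfolding in_segment by (intro conjI exI[of _ "1/2"]) auto
    moreover have "y + (h, 0) \<in> K" "y - (h, 0) \<in> K" using that(2,3) by (auto intro: hull_inc)
    ultimately show False using that(1) unfolding extreme_point_of_def by blast
  qed
  have low: "snd y < 1" if y: "y extreme_point_of K" "n + of_int d \<le> fst y" for y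
  proof (rule ccontr)
    assume y1: "\<not> snd y < 1"
    have S: "y \<in> H \<inter> grid" using y(1) by (rule extreme_mem)
    have "n \<le> (fst y - of_int d) * 1" using y(2) by simp
    also have "\<dots> \<le> (fst y - of_int d) * snd y"
      using y1 y(2) n_pos by (intro mult_left_mono) auto
    finally have "y - (of_int d, 0) \<in> H" using S y(2) n_pos by (simp add: mem_H)
    moreover have "y - (of_int d, 0) = y + (of_int (-1) * of_int d, 0)" by (simp add: prod_eq_iff)
    moreover have "y + (of_int (-1) * of_int d, 0) \<in> grid" using S by (intro grid_shift_x) simp
    ultimately have "y - (of_int d, 0) \<in> H \<inter> grid" by (metis IntI)
    moreover have "y + (of_int d, 0) \<in> H \<inter> grid"
      using grid_shift_x[of y 1] S d_pos hyperbola_region_mono[OF n_pos, of y "y + (of_int d, 0)"] by simp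
    ultimately show False using midpoint[OF y(1), of "of_int d"] d_pos by simp
  qed
  have S: "v \<in> H \<inter> grid" "w \<in> H \<inter> grid" using extreme_mem[OF v(1)] extreme_mem[OF w(1)] .
  obtain z where z: "snd v - snd w = of_int z"
    using grid_diff_Ints(2)[of v w] S by (auto elim: Ints_cases)
  moreover have "- 1 < snd v - snd w" "snd v - snd w < 1" using low[OF v] low[OF w] S by (auto simp: mem_H)
  ultimately have "z = 0" by linarith
  then have y: "snd v = snd w" using z by simp
  \<comment> \<open>In a common row the right one of two points is the midpoint of the left one and
    its mirror image.\<close>
  have False if "fst y < fst z" "snd y = snd z" "y \<in> H \<inter> grid" "z extreme_point_of K" for y z
  proof -
    have z: "z \<in> H \<inter> grid" using that(4) by (rule extreme_mem)
    have e: "(fst z - fst y, 0) = z - y" using that(2) by (simp add: prod_eq_iff)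
    have "z + (fst z - fst y, 0) \<in> H \<inter> grid"
      using grid_add_diff[of z z y] hyperbola_region_mono[OF n_pos, of z "z + (z - y)"] z that
      unfolding e by simp
    moreover have "z - (fst z - fst y, 0) \<in> H \<inter> grid" using that(3) unfolding e by simp
    ultimately show False using midpoint[OF that(4), of "fst z - fst y"] that(1) by simp
  qed
  then show ?thesis using y S v w by (metis linorder_neqE prod_eq_iff)
qed

text \<open>Uniqueness beyond \<open>n + d\<close> keeps \<open>v\<close> first when the threshold
  is lowered. The clamp bounds the abscissa of \<open>L\<close>, as \<open>wide_wedge_stuck\<close>
  requires.\<close>

lemma first_vertex_clamp:
  assumes "first_vertex x v"
  shows "first_vertex (min x (n + of_int d)) v"
proof (cases "x \<le> n + of_int d")
  case True
  then show ?thesis using assms by (simp add: min_absorb1)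
next
  case False
  then have "n + of_int d \<le> fst v" and "v extreme_point_of K" using first_vertexD[OF assms] by auto
  moreover from this have "w = v" if "w extreme_point_of K" "n + of_int d \<le> fst w" for w
    using extreme_far_right_unique that by blast
  ultimately show ?thesis using False unfolding first_vertex_def by (metis min.absorb2 nle_le)
qed

end

section \<open>Passage from a reduced lattice to the grid\<close>

lemma first_vertex_from_iff:
  assumes "0 < n" "standard_basis \<Lambda> (1, a) (0, d)"
  shows "first_vertex_from n p \<Lambda> x v \<longleftrightarrow> hyperbola_lattice.first_vertex n p a d x v"
proof -
  have "0 < d" and "\<Lambda> = {(i * 1 + j * 0, i * a + j * d) | i j. True}"
    using assms(2) unfolding standard_basis_def lattice_basis_def fst_conv snd_conv by blast+
  then have L: "\<Lambda> = {(i, a * i + d * j) | i j. True}" by (simp add: mult.commute)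
  interpret hyperbola_lattice n p a d
    using assms(1) \<open>0 < d\<close> by unfold_locales
  have "translate p \<Lambda> = grid"
  proof (intro subset_antisym subsetI)
    fix P assume "P \<in> translate p \<Lambda>"
    then obtain x y where P: "(x, y) \<in> \<Lambda>" "P = p + (of_int x, of_int y)"
      unfolding translate_def by auto
    then obtain i j where "P = p + (of_int i, of_int (a * i + d * j))"
      unfolding L by blast
    then show "P \<in> grid" unfolding grid_def by blast
  next
    fix P assume "P \<in> grid"
    then obtain i j where "P = p + (of_int i, of_int (a * i + d * j))"
      unfolding grid_def by blast
    moreover have "(i, a * i + d * j) \<in> \<Lambda>" unfolding L by blast
    ultimately show "P \<in> translate p \<Lambda>"
      unfolding translate_def by (intro image_eqI[of _ _ "(i, a * i + d * j)"]) simp_all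
  qed
  then show ?thesis
    unfolding first_vertex_from_def first_vertex_def hyperbola_hull_def by simp
qed

text \<open>As \<open>fst b2 = 0\<close>, all abscissas in the lattice are multiples of
  \<open>fst b1\<close>; surjectivity of the projection forces \<open>fst b1 = 1\<close>.\<close>

lemma reduced_standard_basis:
  assumes "standard_basis \<Lambda> b1 b2" "reduced_lattice \<Lambda>"
  shows "b1 = (1, snd b1)" "b2 = (0, snd b2)" "lattice_det \<Lambda> = snd b2"
proof -
  have b: "lattice_basis \<Lambda> b1 b2" "fst b2 = 0" "0 < fst b1" "0 < snd b2"
    using assms(1) by (auto simp: standard_basis_def)
  have "1 \<in> fst ` \<Lambda>" using assms(2) by (simp add: reduced_lattice_def)
  then obtain i where "1 = i * fst b1" using b(1,2) by (auto simp: lattice_basis_def)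
  then have b1: "fst b1 = 1" using b(3) by (metis dvd_triv_right zdvd1_eq abs_of_pos)
  then show "b1 = (1, snd b1)" "b2 = (0, snd b2)" using b(2) by (simp_all add: prod_eq_iff)
  show "lattice_det \<Lambda> = snd b2" using lattice_det_eq[OF b(1)] b b1 by (simp add: pair_det_def)
qed

subsection \<open>The program\<close>

fun seqs :: "com list \<Rightarrow> com" where
  "seqs [] = Skip"
| "seqs (c # cs) = Seq c (seqs cs)"

text \<open>A point occupies two consecutive registers. Registers 0-7 hold the input, 8/9 and 10/11 the
  points \<open>L\<close> and \<open>R\<close>, 12/13 the point \<open>Q\<close>, 14 the loop flag, 15 a column index; 20/21 and 22/23 are the
  base point and the direction of a ray, and 24 receives its entry index.\<close>

definition point_at :: "state \<Rightarrow> nat \<Rightarrow> real \<times> real" where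
  "point_at s r = (s r, s (Suc r))"

definition inside_test :: "aexp \<Rightarrow> aexp \<Rightarrow> bexp" where
  "inside_test x y = Conj (Less (Lit 0) x) (Conj (Less (Lit 0) y) (Neg (Less (Mul x y) (Reg 0))))"

definition ray_x :: aexp where "ray_x = Add (Reg 20) (Mul (Reg 24) (Reg 22))"
definition ray_y :: aexp where "ray_y = Add (Reg 21) (Mul (Reg 24) (Reg 23))"

definition entry_com :: com where
  "entry_com =
     (let A = Mul (Reg 22) (Reg 23);
          B = Add (Mul (Reg 20) (Reg 23)) (Mul (Reg 21) (Reg 22));
          XY = Mul (Reg 20) (Reg 21) in
      seqs [
        Ite (Eq A (Lit 0))
          (Assign 24 (IDiv (Sub (Reg 0) XY) B))
          (Assign 24 (IDiv (Sub (ISqrt (Sub (Mul B B) (Mul (Mul (Lit 4) A) (Sub XY (Reg 0))))) B)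
             (Mul (Lit 2) A))),
        Ite (inside_test ray_x ray_y) Skip
          (Seq (Assign 24 (Add (Reg 24) (Lit 1)))
            (Ite (inside_test ray_x ray_y) Skip (Assign 24 (Add (Reg 24) (Lit 1)))))])"

text \<open>Registers 20 to 24 are expected to hold \<open>Q\<close>, \<open>R - L\<close> and the
  entry index. The slide runs along \<open>Q' - L\<close>, but its last point is found as the entry
  point in the opposite direction \<open>L - Q'\<close>.\<close>

definition replace :: "nat \<Rightarrow> nat \<Rightarrow> com" where
  "replace l r = seqs [
     Assign 12 (Add (Reg 20) (Mul (Sub (Reg 24) (Lit 1)) (Reg 22))),
     Assign 13 (Add (Reg 21) (Mul (Sub (Reg 24) (Lit 1)) (Reg 23))),
     Assign 20 (Add (Reg 12) (Reg 22)), Assign 21 (Add (Reg 13) (Reg 23)),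
     Assign 22 (Sub (Reg l) (Reg 12)), Assign 23 (Sub (Reg (Suc l)) (Reg 13)),
     entry_com,
     Assign r ray_x, Assign (Suc r) ray_y, Assign 14 (Lit 1)]"

definition attempt :: "nat \<Rightarrow> nat \<Rightarrow> com" where
  "attempt l r = seqs [
     Assign 20 (Reg 12), Assign 21 (Reg 13),
     Assign 22 (Sub (Reg r) (Reg l)), Assign 23 (Sub (Reg (Suc r)) (Reg (Suc l))),
     entry_com,
     Ite (Conj (Less (Lit 0) (Reg 24)) (inside_test ray_x ray_y))
       (replace l r)
       (Assign 14 (Lit 0))]"

text \<open>The left end is tried only after the right end could not be replaced, so a final flag 0
  means that both failed.\<close>

definition body :: com where
  "body = Seq (attempt 8 10) (Ite (Eq (Reg 14) (Lit 0)) (attempt 10 8) Skip)"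

text \<open>The integer quotient tells how often \<open>d\<close> can be subtracted from the height
  without leaving \<open>H\<close>, so the lowest point of the column results.\<close>

definition column :: "nat \<Rightarrow> com" where
  "column r = seqs [
     Assign r (Add (Reg 1) (Reg 15)),
     Assign 16 (Add (Reg 2) (Mul (Reg 4) (Reg 15))),
     Assign (Suc r) (Sub (Reg 16)
       (Mul (Reg 6) (IDiv (Sub (Mul (Reg 16) (Reg r)) (Reg 0)) (Mul (Reg 6) (Reg r)))))]"

text \<open>Division by 1 is the floor; the two sign changes make it the ceiling, which selects the
  first column not left of the clamped start.\<close>

definition start_right :: com where
  "start_right = seqs [
     Ite (Less (Add (Reg 0) (Reg 6)) (Reg 7)) (Assign 7 (Add (Reg 0) (Reg 6))) Skip,
     Assign 15 (Sub (Lit 0) (IDiv (Sub (Reg 1) (Reg 7)) (Lit 1))),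
     column 10]"

text \<open>\<open>L\<close> is taken from the column just before that of \<open>R\<close>, and
  \<open>Q\<close> is the lattice point directly below \<open>L\<close>, which gives determinant
  \<open>- d\<close>.\<close>

definition start_left :: com where
  "start_left = seqs [
     Assign 15 (Sub (Reg 15) (Lit 1)), column 8,
     Assign 12 (Reg 8), Assign 13 (Sub (Reg 9) (Reg 6)), Assign 14 (Lit 1)]"

text \<open>The last point of \<open>H\<close> on the ray beyond \<open>R\<close> is again computed
  as the entry point in the reverse direction \<open>L - R\<close>.\<close>

definition finish :: com where
  "finish = seqs [
     Assign 20 (Reg 10), Assign 21 (Reg 11),
     Assign 22 (Sub (Reg 8) (Reg 10)), Assign 23 (Sub (Reg 9) (Reg 11)),
     entry_com, Assign 0 ray_x, Assign 1 ray_y]"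

definition output_right :: com where
  "output_right = seqs [Assign 0 (Reg 10), Assign 1 (Reg 11)]"

definition more :: bexp where "more = Eq (Reg 14) (Lit 1)"

text \<open>Columns are one unit apart, so a column of positive abscissa precedes that of
  \<open>R\<close> exactly when the abscissa of \<open>R\<close> exceeds 1. Otherwise
  \<open>R\<close> itself is output.\<close>

definition program :: com where
  "program = Seq start_right
     (Ite (Less (Lit 1) (Reg 10)) (Seq start_left (Seq (While more body) finish)) output_right)"

section \<open>Effect of the program fragments on the state\<close>

lemma bval_inside_test:
  assumes "0 < s 0"
  shows "bval (inside_test x y) s \<longleftrightarrow> (aval x s, aval y s) \<in> hyperbola_region (s 0)"
  using assms by (auto simp: inside_test_def mem_hyperbola_region)

lemma bval_ray_test:
  assumes "0 < s 0"
  shows "bval (inside_test ray_x ray_y) s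
    \<longleftrightarrow> point_at s 20 + s 24 *\<^sub>R point_at s 22 \<in> hyperbola_region (s 0)"
  using assms by (subst bval_inside_test) (simp_all add: ray_x_def ray_y_def point_at_def)

lemma run_entry_com:
  assumes "0 < s 0"
  shows "run entry_com s = s(24 := of_int (entry_index (s 0) (point_at s 20) (point_at s 22)))"
proof -
  define g where "g = entry_guess (s 0) (point_at s 20) (point_at s 22)"
  define c where "c = seqs [
        Ite (inside_test ray_x ray_y) Skip
          (Seq (Assign 24 (Add (Reg 24) (Lit 1)))
            (Ite (inside_test ray_x ray_y) Skip (Assign 24 (Add (Reg 24) (Lit 1)))))]"
  have 1: "run entry_com s = run c (s(24 := of_int g))"
    unfolding entry_com_def c_def g_def entry_guess_def point_at_def Let_def
    by (simp add: algebra_simps del: fun_upd_apply)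
  have ray: "bval (inside_test ray_x ray_y) (s(24 := k))
      \<longleftrightarrow> point_at s 20 + k *\<^sub>R point_at s 22 \<in> hyperbola_region (s 0)" for k
    using assms by (subst bval_ray_test) (simp_all add: point_at_def)
  have 2: "run c (s(24 := of_int g)) = s(24 := of_int (entry_index (s 0) (point_at s 20) (point_at s 22)))"
    unfolding c_def entry_index_def Let_def g_def[symmetric]
    by (simp add: ray add.assoc)
  show ?thesis using 1 2 by simp
qed

lemma run_attempt:
  fixes s l r
  assumes "0 < s 0" and lr: "l = 8 \<and> r = 10 \<or> l = 10 \<and> r = 8"
  defines "L \<equiv> point_at s l" and "R \<equiv> point_at s r" and "Q \<equiv> point_at s 12"
  defines "j \<equiv> entry_index (s 0) Q (R - L)"
  defines "Q' \<equiv> Q + (of_int j - 1) *\<^sub>R (R - L)"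
  defines "i \<equiv> entry_index (s 0) (Q' + (R - L)) (L - Q')"
  defines "s' \<equiv> run (attempt l r) s"
  shows "0 < j \<Longrightarrow> Q + of_int j *\<^sub>R (R - L) \<in> hyperbola_region (s 0) \<Longrightarrow>
      s' 0 = s 0 \<and> s' 14 = 1 \<and> point_at s' l = L \<and> point_at s' 12 = Q' \<and>
      point_at s' r = Q' + (R - L) + of_int i *\<^sub>R (L - Q')"
    and "\<not> (0 < j \<and> Q + of_int j *\<^sub>R (R - L) \<in> hyperbola_region (s 0)) \<Longrightarrow>
      s' 0 = s 0 \<and> s' 14 = 0 \<and> point_at s' l = L \<and> point_at s' 12 = Q \<and> point_at s' r = R"
proof -
  \<comment> \<open>The states \<open>s1\<close> to \<open>s5\<close> are reached after loading the
    ray from \<open>Q\<close>, computing its entry index, loading \<open>Q'\<close> and the reversed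
    slide, computing its index, and storing the moved end.\<close>
  define s1 where "s1 = s(20 := s 12, 21 := s 13, 22 := s r - s l, 23 := s (Suc r) - s (Suc l))"
  have p1: "point_at s1 20 = Q" "point_at s1 22 = R - L" "s1 0 = s 0"
    using lr by (auto simp: point_at_def s1_def L_def R_def Q_def)
  define s2 where "s2 = s1(24 := of_int j)"
  have s2: "run entry_com s1 = s2"
    using run_entry_com[of s1] assms(1) p1 by (simp add: s2_def j_def)
  have p2: "point_at s2 20 = Q" "point_at s2 22 = R - L" "s2 24 = of_int j" "s2 0 = s 0"
    using p1 by (simp_all add: s2_def point_at_def)
  have test: "bval (inside_test ray_x ray_y) s2
      \<longleftrightarrow> Q + of_int j *\<^sub>R (R - L) \<in> hyperbola_region (s 0)"
    using bval_ray_test[of s2] assms(1) p2 by simp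
  define s3 where "s3 = s2(12 := fst Q', 13 := snd Q', 20 := fst (Q' + (R - L)), 21 := snd (Q' + (R - L)),
      22 := fst (L - Q'), 23 := snd (L - Q'))"
  have p3: "point_at s3 20 = Q' + (R - L)" "point_at s3 22 = L - Q'" "s3 0 = s 0"
    using p2(4) by (simp_all add: point_at_def s3_def prod_eq_iff)
  define s4 where "s4 = s3(24 := of_int i)"
  have s4: "run entry_com s3 = s4"
    using run_entry_com[of s3] assms(1) p3 by (simp add: s4_def i_def)
  define s5 where "s5 = s4(r := fst (Q' + (R - L) + of_int i *\<^sub>R (L - Q')),
      Suc r := snd (Q' + (R - L) + of_int i *\<^sub>R (L - Q')), 14 := 1)"
  have "run (Seq (Assign 20 (Reg 12)) (Seq (Assign 21 (Reg 13))
       (Seq (Assign 22 (Sub (Reg r) (Reg l))) (Assign 23 (Sub (Reg (Suc r)) (Reg (Suc l))))))) s = s1"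
    using lr by (auto simp: s1_def)
  then have start: "s' = run (Ite (Conj (Less (Lit 0) (Reg 24)) (inside_test ray_x ray_y))
       (replace l r)
       (Assign 14 (Lit 0))) s2"
    unfolding s'_def attempt_def seqs.simps run.simps by (simp only: s2)
  have "run (seqs [
         Assign 12 (Add (Reg 20) (Mul (Sub (Reg 24) (Lit 1)) (Reg 22))),
         Assign 13 (Add (Reg 21) (Mul (Sub (Reg 24) (Lit 1)) (Reg 23))),
         Assign 20 (Add (Reg 12) (Reg 22)), Assign 21 (Add (Reg 13) (Reg 23)),
         Assign 22 (Sub (Reg l) (Reg 12)), Assign 23 (Sub (Reg (Suc l)) (Reg 13))]) s2 = s3"
    using lr by (auto simp: s3_def s2_def s1_def Q'_def Q_def R_def L_def point_at_def)
  moreover have "run (seqs [Assign r ray_x, Assign (Suc r) ray_y, Assign 14 (Lit 1)]) s4 = s5"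
    using lr by (auto simp: s5_def s4_def s3_def ray_x_def ray_y_def)
  ultimately have "run (replace l r) s2 = s5"
    unfolding replace_def using s4 by (simp del: fun_upd_apply)
  moreover have "bval (Conj (Less (Lit 0) (Reg 24)) (inside_test ray_x ray_y)) s2
      \<longleftrightarrow> 0 < j \<and> Q + of_int j *\<^sub>R (R - L) \<in> hyperbola_region (s 0)"
    using test p2(3) by simp
  ultimately have result: "s' = (if 0 < j \<and> Q + of_int j *\<^sub>R (R - L) \<in> hyperbola_region (s 0)
      then s5 else s2(14 := 0))"
    unfolding start run.simps by (simp del: bval.simps)
  have "s5 0 = s 0 \<and> s5 14 = 1 \<and> point_at s5 l = L \<and> point_at s5 12 = Q' \<and>
      point_at s5 r = Q' + (R - L) + of_int i *\<^sub>R (L - Q')"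
    using lr by (elim disjE conjE; hypsubst)
      (simp_all add: s5_def s4_def s3_def s2_def s1_def point_at_def L_def prod_eq_iff)
  then show "0 < j \<Longrightarrow> Q + of_int j *\<^sub>R (R - L) \<in> hyperbola_region (s 0) \<Longrightarrow>
      s' 0 = s 0 \<and> s' 14 = 1 \<and> point_at s' l = L \<and> point_at s' 12 = Q' \<and>
      point_at s' r = Q' + (R - L) + of_int i *\<^sub>R (L - Q')"
    unfolding result by simp
  have "(s2(14 := 0)) 0 = s 0 \<and> (s2(14 := 0)) 14 = 0 \<and> point_at (s2(14 := 0)) l = L \<and>
      point_at (s2(14 := 0)) 12 = Q \<and> point_at (s2(14 := 0)) r = R"
    using lr by (elim disjE conjE; hypsubst) (simp_all add: s2_def s1_def point_at_def L_def Q_def R_def)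
  then show "\<not> (0 < j \<and> Q + of_int j *\<^sub>R (R - L) \<in> hyperbola_region (s 0)) \<Longrightarrow>
      s' 0 = s 0 \<and> s' 14 = 0 \<and> point_at s' l = L \<and> point_at s' 12 = Q \<and> point_at s' r = R"
    unfolding result by (simp only: if_False)
qed

section \<open>Correctness and number of rounds of the loop\<close>

context hyperbola_lattice
begin

text \<open>If any positive index hits \<open>H\<close>, the computed one is the first such index; a
  failed test therefore excludes them all.\<close>

lemma entry_index_hit:
  assumes w: "wedge \<sigma> L R Q W"
  defines "j \<equiv> entry_index n Q (R - L)"
  shows "0 < j \<Longrightarrow> Q + of_int j *\<^sub>R (R - L) \<in> H \<Longrightarrow> Q + (of_int j - 1) *\<^sub>R (R - L) \<notin> H"
    and "\<not> (0 < j \<and> Q + of_int j *\<^sub>R (R - L) \<in> H) \<Longrightarrow> 1 \<le> i \<Longrightarrow> Q + of_int i *\<^sub>R (R - L) \<notin> H"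
proof -
  have g: "R \<in> grid" "L \<in> grid" using w by (auto simp: wedge_def)
  have found: "0 < j \<and> Q + of_int j *\<^sub>R (R - L) \<in> H \<and> Q + (of_int j - 1) *\<^sub>R (R - L) \<notin> H"
    if hit: "Q + of_int i *\<^sub>R (R - L) \<in> H" "1 \<le> i" for i :: int
  proof -
    obtain i' :: int where i': "1 \<le> i'" "Q + of_int i' *\<^sub>R (R - L) \<in> H"
      "Q + (of_int i' - 1) *\<^sub>R (R - L) \<notin> H"
      using wedge_jump_exists[OF w hit] by blast
    have "j = i'"
      unfolding j_def using entry_index_eq[OF n_pos grid_diff_Ints[OF g] i'(2,3)] .
    then show ?thesis using i' by simp
  qed
  show "Q + (of_int j - 1) *\<^sub>R (R - L) \<notin> H" if "0 < j" "Q + of_int j *\<^sub>R (R - L) \<in> H"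
    using found[OF that(2)] that(1) by simp
  show "Q + of_int i *\<^sub>R (R - L) \<notin> H" if "\<not> (0 < j \<and> Q + of_int j *\<^sub>R (R - L) \<in> H)" "1 \<le> i"
    using found[of i] that by blast
qed

lemma run_attempt_wedge:
  fixes s l r
  assumes n: "s 0 = n" and lr: "l = 8 \<and> r = 10 \<or> l = 10 \<and> r = 8"
    and w: "wedge \<sigma> (point_at s l) (point_at s r) (point_at s 12) W"
  defines "s' \<equiv> run (attempt l r) s" and "V \<equiv> \<sigma> * (s r - s l)"
  shows "s' 0 = n \<and> point_at s' l = point_at s l \<and>
     (s' 14 = 1 \<and> wedge \<sigma> (point_at s l) (point_at s' r) (point_at s' 12) V \<and>
        V + W \<le> \<sigma> * (s' r - s l) \<and>
        (\<exists>j::int. 1 \<le> j \<and> point_at s 12 + of_int j *\<^sub>R (point_at s r - point_at s l) \<in> H) \<or>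
      s' 14 = 0 \<and> point_at s' r = point_at s r \<and> point_at s' 12 = point_at s 12 \<and>
        (\<forall>j::int. 1 \<le> j \<longrightarrow> point_at s 12 + of_int j *\<^sub>R (point_at s r - point_at s l) \<notin> H))"
proof -
  define L R Q where "L = point_at s l" and "R = point_at s r" and "Q = point_at s 12"
  define j where "j = entry_index n Q (R - L)"
  define Q' where "Q' = Q + (of_int j - 1) *\<^sub>R (R - L)"
  define i where "i = entry_index n (Q' + (R - L)) (L - Q')"
  note defs = L_def[symmetric] R_def[symmetric] Q_def[symmetric]
  note fold = n defs j_def[symmetric] Q'_def[symmetric] i_def[symmetric]
  note W = w[unfolded defs]
  note run = run_attempt[OF _ lr, of s, unfolded fold, folded s'_def, OF n_pos]
  have V: "V = \<sigma> * (fst R - fst L)" by (simp add: V_def R_def L_def point_at_def)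
  show ?thesis
  proof (cases "0 < j \<and> Q + of_int j *\<^sub>R (R - L) \<in> H")
    case False
    then show ?thesis
      using run(2)[OF False] entry_index_hit(2)[OF W, folded j_def, OF False] unfolding defs by blast
  next
    case True
    have out: "Q' \<notin> H" using entry_index_hit(1)[OF W] True by (simp add: j_def Q'_def)
    have g: "L \<in> grid" "R \<in> grid" "Q \<in> grid" "L \<in> H" using W by (auto simp: wedge_def)
    have gQ: "Q' \<in> grid" using grid_add_multiple[OF g(3,2,1), of "j - 1"] by (simp add: Q'_def)
    have eq: "Q + of_int j *\<^sub>R (R - L) = Q' + (R - L)" by (simp add: Q'_def algebra_simps)
    have "fst (Q' - L) < 0 \<or> snd (Q' - L) < 0"
      using leaving_hyperbola_region[OF n_pos g(4) out] .
    then obtain k where k: "0 \<le> k" "Q' + (R - L) + of_int k *\<^sub>R (Q' - L) \<in> H"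
      "Q' + (R - L) + (of_int k + 1) *\<^sub>R (Q' - L) \<notin> H"
      using last_inside_hyperbola_region[OF n_pos _ grid_diff_Ints[OF gQ g(1)]] True eq by metis
    have neg: "of_int (- k) *\<^sub>R (L - Q') = of_int k *\<^sub>R (Q' - L)"
      "(of_int (- k) - 1) *\<^sub>R (L - Q') = (of_int k + 1) *\<^sub>R (Q' - L)"
      by (simp_all add: algebra_simps)
    \<comment> \<open>The last point of \<open>H\<close> in direction \<open>Q' - L\<close> is the
      entry point in direction \<open>L - Q'\<close>, with negated index.\<close>
    have "i = - k"
      unfolding i_def
      by (rule entry_index_eq[OF n_pos grid_diff_Ints[OF g(1) gQ]]) (use k(2,3) in \<open>simp_all only: neg not_False_eq_True\<close>)
    then have move: "of_int i *\<^sub>R (L - Q') = of_int k *\<^sub>R (Q' - L)" using neg(1) by simp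
    define R' where "R' = Q' + (R - L) + of_int k *\<^sub>R (Q' - L)"
    have s': "s' 0 = n \<and> s' 14 = 1 \<and> point_at s' l = L \<and> point_at s' 12 = Q' \<and> point_at s' r = R'"
      using run(1) True unfolding move R'_def by blast
    have "R' + (Q' - L) \<notin> H" using k(3) unfolding R'_def by (simp add: algebra_simps)
    moreover have "1 \<le> j" using True by simp
    ultimately have step: "wedge \<sigma> L R' Q' (\<sigma> * (fst R - fst L))"
      "\<sigma> * (fst R - fst L) + W \<le> \<sigma> * (fst R' - fst L)"
      using wedge_step[OF W _ _ Q'_def out k(1) R'_def] True k(2) unfolding R'_def by blast+
    moreover have "fst R' = s' r" "fst L = s l" using s' by (auto simp: L_def point_at_def)
    ultimately show ?thesis using s' True \<open>1 \<le> j\<close> unfolding V defs by auto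
  qed
qed

text \<open>Together with \<open>Q\<close> lying outside \<open>H\<close>, this says that no lattice
  point of the line through \<open>Q\<close> parallel to \<open>LR\<close> is in
  \<open>H\<close>.\<close>

definition stuck :: "state \<Rightarrow> bool" where
  "stuck s \<longleftrightarrow> (\<forall>j::int. 1 \<le> j \<longrightarrow>
     point_at s 12 + of_int j *\<^sub>R (point_at s 10 - point_at s 8) \<notin> H \<and>
     point_at s 12 + of_int j *\<^sub>R (point_at s 8 - point_at s 10) \<notin> H)"

definition bracket :: "real \<Rightarrow> real \<Rightarrow> state \<Rightarrow> bool" where
  "bracket x W s \<longleftrightarrow> s 0 = n \<and> wedge 1 (point_at s 8) (point_at s 10) (point_at s 12) W \<and>
     s 8 < x \<and> x \<le> s 10"

text \<open>\<open>L\<close> only moves left and \<open>R\<close> only right, so \<open>x\<close>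
  stays bracketed. The conjunct \<open>\<not> stuck s\<close> lets a stuck state force termination
  in the next round.\<close>

lemma run_body:
  assumes b: "bracket x W s"
  defines "s' \<equiv> run body s"
  shows "s' 14 = 1 \<and> bracket x (s 10 - s 8) s' \<and> s 10 - s 8 + W \<le> s' 10 - s' 8 \<and> \<not> stuck s \<or>
     s' 14 = 0 \<and> bracket x W s' \<and> stuck s'"
proof -
  have n: "s 0 = n" and w: "wedge 1 (point_at s 8) (point_at s 10) (point_at s 12) W"
    and x: "s 8 < x" "x \<le> s 10" using b by (auto simp: bracket_def)
  have W: "1 \<le> W" using w by (simp add: wedge_def)
  define s1 where "s1 = run (attempt 8 10) s"
  have A1: "s1 0 = n" "point_at s1 8 = point_at s 8"
    "s1 14 = 1 \<and> wedge 1 (point_at s 8) (point_at s1 10) (point_at s1 12) (s 10 - s 8) \<and>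
        s 10 - s 8 + W \<le> s1 10 - s 8 \<and> \<not> stuck s \<or>
      s1 14 = 0 \<and> point_at s1 10 = point_at s 10 \<and> point_at s1 12 = point_at s 12 \<and>
        (\<forall>j::int. 1 \<le> j \<longrightarrow> point_at s 12 + of_int j *\<^sub>R (point_at s 10 - point_at s 8) \<notin> H)"
    using run_attempt_wedge[OF n _ w, folded s1_def] unfolding stuck_def by auto
  have reg: "point_at u k = point_at v k \<Longrightarrow> u k = v k" for u v k by (simp add: point_at_def)
  from A1(3) show ?thesis
  proof (elim disjE conjE)
    assume s1: "s1 14 = 1" "wedge 1 (point_at s 8) (point_at s1 10) (point_at s1 12) (s 10 - s 8)"
      "s 10 - s 8 + W \<le> s1 10 - s 8" "\<not> stuck s"
    have "s' = s1" using s1(1) by (simp add: s'_def body_def s1_def)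
    then show ?thesis
      using A1(1,2) s1 x W reg[OF A1(2)] by (auto simp: bracket_def)
  next
    assume s1: "s1 14 = 0" "point_at s1 10 = point_at s 10" "point_at s1 12 = point_at s 12"
      "\<forall>j::int. 1 \<le> j \<longrightarrow> point_at s 12 + of_int j *\<^sub>R (point_at s 10 - point_at s 8) \<notin> H"
    have s': "s' = run (attempt 10 8) s1" using s1(1) by (simp add: s'_def body_def s1_def)
    have w1: "wedge (-1) (point_at s1 10) (point_at s1 8) (point_at s1 12) W"
      using wedge_swap[OF w] A1(2) s1 by simp
    note e = reg[OF A1(2)] reg[OF s1(2)]
    have "s' 0 = n" "point_at s' 10 = point_at s 10"
      "s' 14 = 1 \<and> wedge (-1) (point_at s 10) (point_at s' 8) (point_at s' 12) (s 10 - s 8) \<and>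
         s 10 - s 8 + W \<le> s 10 - s' 8 \<and> \<not> stuck s \<or>
       s' 14 = 0 \<and> point_at s' 8 = point_at s 8 \<and> point_at s' 12 = point_at s 12 \<and>
        (\<forall>j::int. 1 \<le> j \<longrightarrow> point_at s 12 + of_int j *\<^sub>R (point_at s 8 - point_at s 10) \<notin> H)"
      using run_attempt_wedge[OF A1(1) _ w1, folded s'] unfolding stuck_def A1(2) s1(2,3) e by auto
    then show ?thesis
    proof (elim disjE conjE)
      assume s2: "s' 0 = n" "point_at s' 10 = point_at s 10" "s' 14 = 1"
        "wedge (-1) (point_at s 10) (point_at s' 8) (point_at s' 12) (s 10 - s 8)"
        "s 10 - s 8 + W \<le> s 10 - s' 8" "\<not> stuck s"
      have "wedge 1 (point_at s' 8) (point_at s' 10) (point_at s' 12) (s 10 - s 8)"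
        using wedge_swap[OF s2(4)] s2(2) by simp
      then show ?thesis using s2 x W reg[OF s2(2)] by (auto simp: bracket_def)
    next
      assume s2: "s' 0 = n" "point_at s' 10 = point_at s 10" "s' 14 = 0"
        "point_at s' 8 = point_at s 8" "point_at s' 12 = point_at s 12"
        "\<forall>j::int. 1 \<le> j \<longrightarrow> point_at s 12 + of_int j *\<^sub>R (point_at s 8 - point_at s 10) \<notin> H"
      have "stuck s'" unfolding stuck_def s2(2,4,5) using s1(4) s2(6) by blast
      moreover have "bracket x W s'"
        unfolding bracket_def s2(2,4,5) reg[OF s2(2)] reg[OF s2(4)] using s2(1) w x by blast
      ultimately show ?thesis using s2(3) by blast
    qed
  qed
qed

lemma bracket_wide_stuck:
  assumes "bracket x W s" "x \<le> n + of_int d" "n + of_int d < W"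
  shows "stuck s"
proof -
  have w: "wedge 1 (point_at s 8) (point_at s 10) (point_at s 12) W"
    and "fst (point_at s 8) \<le> n + of_int d"
    using assms by (auto simp: bracket_def point_at_def)
  then show ?thesis using wide_wedge_stuck[OF w assms(3)] unfolding stuck_def by blast
qed

text \<open>The sum of the last two widths grows by a factor of at least \<open>3/2\<close> per iteration, and once it
  exceeds \<open>2 * (n + d)\<close> at most one more replacement is possible.\<close>

lemma loop_iterations:
  assumes "bracket x W s" "s 14 = 1" "x \<le> n + of_int d"
    and "2 * (n + of_int d) < (3/2) ^ m * (W + (s 10 - s 8))"
  shows "\<exists>N \<le> m + 2. (\<forall>i<N. (run body ^^ i) s 14 = 1) \<and> (run body ^^ N) s 14 = 0 \<and>
     (\<exists>W. bracket x W ((run body ^^ N) s)) \<and> stuck ((run body ^^ N) s)"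
  using assms(1,2,4)
proof (induction m arbitrary: s W)
  case 0
  have W: "W \<le> s 10 - s 8" using 0(1) by (simp add: bracket_def wedge_def point_at_def)
  define s1 where "s1 = run body s"
  consider (go) "s1 14 = 1" "bracket x (s 10 - s 8) s1" | (stop) "s1 14 = 0" "bracket x W s1" "stuck s1"
    using run_body[OF 0(1)] by (auto simp: s1_def)
  then show ?case
  proof cases
    case stop
    then show ?thesis using 0(2) by (intro exI[of _ 1]) (auto simp: s1_def)
  next
    case go
    \<comment> \<open>The larger width \<open>s 10 - s 8\<close> exceeds \<open>n + d\<close> and
      serves as \<open>W\<close> of the next bracket.\<close>
    have "stuck s1" using bracket_wide_stuck[OF go(2) assms(3)] 0(3) W by simp
    then have "run body s1 14 = 0 \<and> bracket x (s 10 - s 8) (run body s1) \<and> stuck (run body s1)"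
      using run_body[OF go(2)] by blast
    then show ?thesis using 0(2) go(1)
      by (intro exI[of _ 2]) (auto simp: s1_def numeral_2_eq_2 less_Suc_eq)
  qed
next
  case (Suc m)
  have W: "W \<le> s 10 - s 8" using Suc.prems(1) by (simp add: bracket_def wedge_def point_at_def)
  define s1 where "s1 = run body s"
  consider (go) "s1 14 = 1" "bracket x (s 10 - s 8) s1" "s 10 - s 8 + W \<le> s1 10 - s1 8"
    | (stop) "s1 14 = 0" "bracket x W s1" "stuck s1"
    using run_body[OF Suc.prems(1)] by (auto simp: s1_def)
  then show ?case
  proof cases
    case stop
    then show ?thesis using Suc.prems(2) by (intro exI[of _ 1]) (auto simp: s1_def)
  next
    case go
    \<comment> \<open>With \<open>b = s 10 - s 8\<close> the new sum is at least
      \<open>W + 2 * b\<close>, and \<open>W \<le> b\<close>.\<close>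
    have "(3/2) * (W + (s 10 - s 8)) \<le> s 10 - s 8 + (s1 10 - s1 8)" using go(3) W by simp
    then have "(3/2) ^ m * ((3/2) * (W + (s 10 - s 8))) \<le> (3/2) ^ m * (s 10 - s 8 + (s1 10 - s1 8))"
      by (intro mult_left_mono) auto
    moreover have "(3/2) ^ Suc m * (W + (s 10 - s 8)) = (3/2) ^ m * ((3/2) * (W + (s 10 - s 8)))"
      by simp
    ultimately have "2 * (n + of_int d) < (3/2) ^ m * (s 10 - s 8 + (s1 10 - s1 8))"
      using Suc.prems(3) by linarith
    from Suc.IH[OF go(2,1) this] obtain N where N: "N \<le> m + 2"
      "\<forall>i<N. (run body ^^ i) s1 14 = 1" "(run body ^^ N) s1 14 = 0"
      "\<exists>W. bracket x W ((run body ^^ N) s1)" "stuck ((run body ^^ N) s1)"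
      by blast
    have shift: "(run body ^^ Suc i) s = (run body ^^ i) s1" for i
      by (simp add: s1_def funpow_swap1)
    have "(run body ^^ i) s 14 = 1" if "i < Suc N" for i
    proof (cases i)
      case 0
      then show ?thesis using Suc.prems(2) by simp
    next
      case (Suc k)
      then have "k < N" using that by simp
      then show ?thesis unfolding Suc shift using N(2) by blast
    qed
    then show ?thesis
      using N(1,3-5) by (intro exI[of _ "Suc N"]) (simp only: shift, simp)
  qed
qed

end

section \<open>Cost and correctness of the whole program\<close>

lemma while_free_entry_com: "while_free entry_com"
  by (simp add: entry_com_def Let_def)

lemma while_free_parts:
  "while_free body" "while_free start_right" "while_free start_left" "while_free finish"
  "while_free output_right"
  by (simp_all add: body_def attempt_def replace_def start_right_def start_left_def column_def
      finish_def output_right_def while_free_entry_com)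

text \<open>The summand 1 is the branch test of \<open>program\<close>, and
  \<open>bcost more\<close> the failing test that ends the loop.\<close>

definition fixed_cost :: nat where
  "fixed_cost = max_cost start_right + 1 + max_cost start_left + bcost more + max_cost finish
     + max_cost output_right"

definition body_cost :: nat where "body_cost = bcost more + max_cost body"

lemma output_point_run_finish:
  assumes "0 < s 0"
  shows "output_point (run finish s) = point_at s 10
    + of_int (entry_index (s 0) (point_at s 10) (point_at s 8 - point_at s 10)) *\<^sub>R (point_at s 8 - point_at s 10)"
proof -
  define s1 where "s1 = s(20 := s 10, 21 := s 11, 22 := s 8 - s 10, 23 := s 9 - s 11)"
  have p1: "point_at s1 20 = point_at s 10" "point_at s1 22 = point_at s 8 - point_at s 10" "s1 0 = s 0"
    by (simp_all add: s1_def point_at_def)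
  have "run finish s = run (seqs [Assign 0 ray_x, Assign 1 ray_y]) (run entry_com s1)"
    unfolding finish_def s1_def by simp
  also have "run entry_com s1 = s1(24 := of_int (entry_index (s 0) (point_at s 10) (point_at s 8 - point_at s 10)))"
    using run_entry_com[of s1] assms p1 by simp
  finally show ?thesis
    by (simp add: output_point_def ray_x_def ray_y_def s1_def prod_eq_iff) (simp add: point_at_def)
qed

context hyperbola_lattice
begin

lemma run_column:
  fixes i :: int
  assumes s: "s 0 = n" "s 1 = fst p" "s 2 = snd p" "s 4 = of_int a" "s 6 = of_int d" "s 15 = of_int i"
    and r: "r = 8 \<or> r = 10" and pos: "0 < fst p + of_int i"
  defines "s' \<equiv> run (column r) s"
  shows "s' r = fst p + of_int i" "point_at s' r \<in> H \<inter> grid" "point_at s' r - (0, of_int d) \<notin> H"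
    "k \<notin> {r, Suc r, 16} \<Longrightarrow> s' k = s k"
proof -
  define x c where "x = fst p + of_int i" and "c = snd p + of_int a * of_int i"
  define q where "q = \<lfloor>(c * x - n) / (of_int d * x)\<rfloor>"
  have s': "s' = s(r := x, 16 := c, Suc r := c - of_int d * of_int q)"
    using r s by (elim disjE) (simp_all add: s'_def column_def x_def c_def q_def)
  have x: "0 < x" using pos by (simp add: x_def)
  have dx: "0 < of_int d * x" using x d_pos by simp
  have "of_int q \<le> (c * x - n) / (of_int d * x)" "(c * x - n) / (of_int d * x) < of_int q + 1"
    unfolding q_def by linarith+
  then have q: "of_int q * (of_int d * x) \<le> c * x - n" "c * x - n < (of_int q + 1) * (of_int d * x)"
    using dx by (simp_all add: field_simps)
  have P: "point_at s' r = (x, c - of_int d * of_int q)"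
    using r by (auto simp: s' point_at_def)
  show "s' r = fst p + of_int i" using r by (auto simp: s' x_def)
  have ge: "n \<le> x * (c - of_int d * of_int q)" using q(1) by (simp add: algebra_simps)
  then have "0 < x * (c - of_int d * of_int q)" using n_pos by linarith
  then have "0 < c - of_int d * of_int q" using x by (simp add: zero_less_mult_iff)
  then have "point_at s' r \<in> H" using x ge by (simp add: P mem_H)
  moreover have "point_at s' r \<in> grid"
    by (rule gridI[of _ i "- q"]) (simp_all add: P x_def c_def)
  ultimately show "point_at s' r \<in> H \<inter> grid" by blast
  have "x * (c - of_int d * of_int q - of_int d) < n" using q(2) by (simp add: algebra_simps)
  then show "point_at s' r - (0, of_int d) \<notin> H" by (simp add: P mem_H)
  show "k \<notin> {r, Suc r, 16} \<Longrightarrow> s' k = s k" by (simp add: s')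
qed

lemma first_vertex_output:
  assumes b: "bracket x W s" and "stuck s" and v: "first_vertex x v"
  shows "output_point (run finish s) = v"
proof -
  define L R Q where "L = point_at s 8" and "R = point_at s 10" and "Q = point_at s 12"
  note defs = L_def[symmetric] R_def[symmetric] Q_def[symmetric]
  have n: "s 0 = n" and w: "wedge 1 L R Q W" and x: "fst L < x" "x \<le> fst R"
    using b by (auto simp: bracket_def L_def R_def Q_def point_at_def)
  have none: "Q + of_int j *\<^sub>R (R - L) \<notin> H" "Q + of_int j *\<^sub>R (L - R) \<notin> H" if "1 \<le> j" for j :: int
    using assms(2) that by (auto simp: stuck_def defs)
  obtain k :: int where k: "0 \<le> k" "R + of_int k *\<^sub>R (R - L) \<in> H"
    "R + (of_int k + 1) *\<^sub>R (R - L) \<notin> H" "v = R + of_int k *\<^sub>R (R - L)"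
    using first_vertex_on_edge[OF w x wedge_supporting[OF w none] v] by blast
  have neg: "of_int (- k) *\<^sub>R (L - R) = of_int k *\<^sub>R (R - L)"
    "(of_int (- k) - 1) *\<^sub>R (L - R) = (of_int k + 1) *\<^sub>R (R - L)"
    by (simp_all add: algebra_simps)
  have g: "L \<in> grid" "R \<in> grid" using w by (auto simp: wedge_def)
  have "entry_index n R (L - R) = - k"
    by (rule entry_index_eq[OF n_pos grid_diff_Ints[OF g]])
      (use k(2,3) in \<open>simp_all only: neg not_False_eq_True\<close>)
  then have "output_point (run finish s) = R + of_int (- k) *\<^sub>R (L - R)"
    using output_point_run_finish[of s] n n_pos by (simp only: defs)
  then show ?thesis unfolding neg k(4) .
qed

lemma exec_program:
  assumes "0 < x_start" and m: "n + of_int d < (3/2) ^ m"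
  shows "\<exists>t s. exec program (input_state n p (1, a) (0, d) x_start) t s \<and>
     t \<le> fixed_cost + (m + 2) * body_cost \<and> (\<forall>v. first_vertex x_start v \<longrightarrow> output_point s = v)"
proof -
  define s0 where "s0 = input_state n p (1, a) (0, d) x_start"
  define x where "x = min x_start (n + of_int d)"
  have x: "0 < x" "x \<le> n + of_int d" using assms(1) n_pos d_pos by (auto simp: x_def)
  define i where "i = - \<lfloor>fst p - x\<rfloor>"
  have i: "x \<le> fst p + of_int i" "fst p + of_int i < x + 1"
    unfolding i_def by simp_all linarith+
  define s1 where "s1 = s0(7 := x, 15 := of_int i)"
  have s1: "s1 0 = n" "s1 1 = fst p" "s1 2 = snd p" "s1 4 = of_int a" "s1 6 = of_int d" "s1 15 = of_int i"
    by (simp_all add: s1_def s0_def input_state_def)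
  define s2 where "s2 = run (column 10) s1"
  have "run start_right s0 = s2"
    unfolding s2_def s1_def start_right_def
    by (simp add: s0_def input_state_def x_def i_def min_def fun_upd_idem)
  then obtain t1 where t1: "exec start_right s0 t1 s2" "t1 \<le> max_cost start_right"
    using exec_while_free[OF while_free_parts(2), of s0] by metis
  have pos: "0 < fst p + of_int i" using i x by linarith
  note R = run_column[OF s1 _ pos, of 10, folded s2_def, simplified]
  define P where "P = point_at s2 10"
  have P: "P \<in> H \<inter> grid" "P - (0, of_int d) \<notin> H" "fst P = fst p + of_int i" "s2 10 = fst P"
    using R(1-3) by (auto simp: P_def point_at_def)
  have cost: "bcost (Less (Lit 1) (Reg 10)) = 1" by simp
  show ?thesis
  proof (cases "bval (Less (Lit 1) (Reg 10)) s2")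
    case False
    obtain t2 where t2: "exec output_right s2 t2 (run output_right s2)" "t2 \<le> max_cost output_right"
      using exec_while_free[OF while_free_parts(5)] .
    have "exec program s0 (t1 + (bcost (Less (Lit 1) (Reg 10)) + t2)) (run output_right s2)"
      unfolding program_def by (intro exec.Seq[OF t1(1)] exec.IfFalse False t2(1))
    moreover have "output_point (run output_right s2) = P"
      by (simp add: output_right_def output_point_def P_def point_at_def)
    moreover have "v = P" if "first_vertex x_start v" for v
    proof (rule first_vertex_in_first_column[OF P(1) _ P(2)])
      show "fst P \<le> 1" using False P(4) by simp
      show "x \<le> fst P" using i(1) P(3) by simp
      show "first_vertex x v" unfolding x_def using that by (rule first_vertex_clamp)
    qed
    moreover have "t1 + (bcost (Less (Lit 1) (Reg 10)) + t2) \<le> fixed_cost + (m + 2) * body_cost"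
      using t1(2) t2(2) unfolding cost fixed_cost_def by simp
    ultimately show ?thesis unfolding s0_def by blast
  next
    case True
    have pos': "0 < fst p + of_int (i - 1)" using True P(3,4) by simp
    define s3 where "s3 = s2(15 := of_int (i - 1))"
    have s3: "s3 0 = n" "s3 1 = fst p" "s3 2 = snd p" "s3 4 = of_int a" "s3 6 = of_int d"
      "s3 15 = of_int (i - 1)"
      using R(4) s1 by (simp_all add: s3_def)
    define s4 where "s4 = run (column 8) s3"
    note L = run_column[OF s3 _ pos', of 8, folded s4_def, simplified]
    define G where "G = point_at s4 8"
    have G: "G \<in> H \<inter> grid" "G - (0, of_int d) \<notin> H" "fst G = fst P - 1" "s4 8 = fst G"
      using L(1-3) P(3) by (auto simp: G_def point_at_def)
    define s5 where "s5 = s4(12 := s4 8, 13 := s4 9 - of_int d, 14 := 1)"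
    have "run start_left s2 = s5"
      unfolding start_left_def s5_def using R(4) s1 L(4) s3
      by (simp add: s4_def s3_def)
    then obtain t2 where t2: "exec start_left s2 t2 s5" "t2 \<le> max_cost start_left"
      using exec_while_free[OF while_free_parts(3), of s2] by metis
    have p5: "point_at s5 8 = G" "point_at s5 10 = P" "point_at s5 12 = G - (0, of_int d)" "s5 0 = n" "s5 14 = 1"
      using L(4) s3 by (simp_all add: s5_def G_def P_def point_at_def s3_def)
    have r5: "s5 8 = fst G" "s5 10 = fst P" using p5 by (auto simp: point_at_def)
    have "G + (0, of_int (-1) * of_int d) \<in> grid" using G(1) by (intro grid_shift_y) simp
    moreover have "G + (0, of_int (-1) * of_int d) = G - (0, of_int d)" by (simp add: prod_eq_iff)
    ultimately have g: "G - (0, of_int d) \<in> grid" by metis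
    have e: "P + (G - (0, of_int d) - G) = P - (0, of_int d)" by simp
    \<comment> \<open>Here \<open>P + (Q - L)\<close> is the point below \<open>P\<close>, which is
      outside \<open>H\<close>; so the first alternative of \<open>wedge\<close> holds with both
      widths equal to 1.\<close>
    have "wedge 1 G P (G - (0, of_int d)) 1"
      unfolding wedge_def e using G P g by (simp add: cross_def)
    then have b: "bracket x 1 s5"
      unfolding bracket_def p5 r5 using i P(3) G(3) by simp
    \<comment> \<open>The initial sum of widths is 2, which cancels the factor 2.\<close>
    have "2 * (n + of_int d) < (3/2) ^ m * (1 + (s5 10 - s5 8))" using m G(3) r5 by simp
    from loop_iterations[OF b p5(5) x(2) this] obtain N W where N: "N \<le> m + 2"
      "\<forall>i<N. (run body ^^ i) s5 14 = 1" "(run body ^^ N) s5 14 = 0"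
      "bracket x W ((run body ^^ N) s5)" "stuck ((run body ^^ N) s5)"
      by blast
    define s6 where "s6 = (run body ^^ N) s5"
    obtain t3 where t3: "exec (While more body) s5 t3 s6"
      "t3 \<le> N * (bcost more + max_cost body) + bcost more"
      unfolding s6_def
    proof (rule exec_While_iterate[OF while_free_parts(1), of N more s5])
      show "bval more ((run body ^^ i) s5)" if "i < N" for i using N(2) that by (simp add: more_def)
      show "\<not> bval more ((run body ^^ N) s5)" using N(3) by (simp add: more_def)
    qed
    obtain t4 where t4: "exec finish s6 t4 (run finish s6)" "t4 \<le> max_cost finish"
      using exec_while_free[OF while_free_parts(4)] .
    have "exec program s0 (t1 + (bcost (Less (Lit 1) (Reg 10)) + (t2 + (t3 + t4)))) (run finish s6)"
      unfolding program_def by (intro exec.Seq[OF t1(1)] exec.IfTrue[OF True] exec.Seq[OF t2(1)] exec.Seq[OF t3(1) t4(1)])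
    moreover have "N * body_cost \<le> (m + 2) * body_cost" using N(1) by (rule mult_le_mono1)
    then have "t1 + (bcost (Less (Lit 1) (Reg 10)) + (t2 + (t3 + t4))) \<le> fixed_cost + (m + 2) * body_cost"
      using t1(2) t2(2) t3(2) t4(2) unfolding cost fixed_cost_def body_cost_def[symmetric] by linarith
    moreover have "output_point (run finish s6) = v" if "first_vertex x_start v" for v
      using first_vertex_output[OF N(4,5)] first_vertex_clamp[OF that] unfolding x_def s6_def by blast
    ultimately show ?thesis unfolding s0_def by blast
  qed
qed

end

text \<open>\<open>m\<close> is the logarithm of \<open>T\<close> to base 3/2, rounded down, plus 1.
  The estimate \<open>1 - 1 / y \<le> ln y\<close> gives \<open>1/3 \<le> ln (3/2)\<close> and
  \<open>1/2 \<le> ln 2\<close>, so with \<open>l = ln (max 2 T)\<close> one has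
  \<open>m \<le> 3 * l + 1 \<le> 5 * l\<close>.\<close>

lemma log_iteration_bound:
  fixes T :: real
  assumes "1 < T"
  obtains m :: nat where "T < (3/2) ^ m" "real m \<le> 5 * ln (max 2 T)" "1/2 \<le> ln (max 2 T)"
proof -
  define l where "l = ln (max 2 T)"
  have low: "1 - 1 / y \<le> ln y" if "0 < y" for y :: real
    using ln_le_minus_one[of "1 / y"] that by (simp add: ln_div)
  have "ln 2 \<le> l" "ln T \<le> l" using assms by (auto simp: l_def)
  then have l: "1/2 \<le> l" using low[of 2] by simp
  have c: "1/3 \<le> ln (3/2 :: real)" using low[of "3/2"] by simp
  define m where "m = Suc (nat \<lfloor>ln T / ln (3/2)\<rfloor>)"
  have q: "0 \<le> ln T / ln (3/2)" using assms c by simp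
  then have m: "ln T / ln (3/2) < real m" "real m \<le> ln T / ln (3/2) + 1"
    unfolding m_def by linarith+
  have "ln T < real m * ln (3/2)" using m(1) c by (simp add: field_simps)
  also have "\<dots> = ln ((3/2) ^ m)" by (simp add: ln_realpow)
  finally have "T < (3/2) ^ m" using assms by simp
  moreover have "ln T / ln (3/2) \<le> ln T / (1/3)"
    using c assms by (intro divide_left_mono) auto
  then have "real m \<le> 5 * l" using m(2) l \<open>ln T \<le> l\<close> by simp
  ultimately show ?thesis using that l unfolding l_def by blast
qed

theorem theorem3p14:
  shows "\<exists>(c :: com) (C :: real). \<forall>(n :: real) (p :: real \<times> real) (\<Lambda> :: (int \<times> int) set)
           (b1 :: int \<times> int) (b2 :: int \<times> int) (x_start :: real).
           0 < n \<and> sublattice \<Lambda> \<and> reduced_lattice \<Lambda> \<and> standard_basis \<Lambda> b1 b2 \<and> 0 < x_start \<longrightarrow>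
           (\<exists>t s. exec c (input_state n p b1 b2 x_start) t s \<and>
                  real t \<le> C * (ln (max 2 (n + real_of_int (lattice_det \<Lambda>))))\<^sup>2 \<and>
                  (\<forall>v. first_vertex_from n p \<Lambda> x_start v \<longrightarrow> output_point s = v))"
proof (rule exI[of _ program], rule exI[of _ "4 * real fixed_cost + 18 * real body_cost"], intro allI impI)
  fix n :: real and p :: "real \<times> real" and \<Lambda> b1 b2 and x_start :: real
  assume asm: "0 < n \<and> sublattice \<Lambda> \<and> reduced_lattice \<Lambda> \<and> standard_basis \<Lambda> b1 b2 \<and> 0 < x_start"
  define a d where "a = snd b1" and "d = snd b2"
  have b: "b1 = (1, a)" "b2 = (0, d)" and det: "lattice_det \<Lambda> = d"
    using reduced_standard_basis[of \<Lambda> b1 b2] asm by (auto simp: a_def d_def)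
  have basis: "standard_basis \<Lambda> (1, a) (0, d)" using asm b by simp
  then have d: "0 < d" by (simp add: standard_basis_def)
  interpret hyperbola_lattice n p a d using asm d by unfold_locales auto
  have T: "1 < n + real_of_int d" using asm d by linarith
  define l where "l = ln (max 2 (n + real_of_int d))"
  obtain m where m: "n + real_of_int d < (3/2) ^ m" "real m \<le> 5 * l" "1/2 \<le> l"
    using log_iteration_bound[OF T] unfolding l_def .
  obtain t s where ts: "exec program (input_state n p (1, a) (0, d) x_start) t s"
    "t \<le> fixed_cost + (m + 2) * body_cost" "\<forall>v. first_vertex x_start v \<longrightarrow> output_point s = v"
    using exec_program[OF _ m(1)] asm by blast
  \<comment> \<open>These bounds turn constants and linear terms into squares:
    \<open>m + 2 \<le> 5 * l + 2 \<le> 10 * l\<^sup>2 + 8 * l\<^sup>2\<close>, whence the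
    coefficients 4 and 18.\<close>
  have l2: "1 \<le> 4 * l\<^sup>2" "l \<le> 2 * l\<^sup>2"
    using m(3) mult_mono[of "1/2" l "1/2" l] mult_right_mono[of "1/2" l l] by (simp_all add: power2_eq_square)
  have "real t \<le> real fixed_cost + (real m + 2) * real body_cost"
    using ts(2) by (metis of_nat_add of_nat_le_iff of_nat_mult of_nat_numeral)
  also have "\<dots> \<le> real fixed_cost * (4 * l\<^sup>2) + (18 * l\<^sup>2) * real body_cost"
    using m(2) l2 mult_left_mono[OF l2(1), of "real fixed_cost"]
    by (intro add_mono mult_right_mono) simp_all
  also have "\<dots> = (4 * real fixed_cost + 18 * real body_cost) * l\<^sup>2"
    by (simp add: algebra_simps)
  finally show "\<exists>t s. exec program (input_state n p b1 b2 x_start) t s \<and>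
      real t \<le> (4 * real fixed_cost + 18 * real body_cost) * (ln (max 2 (n + real_of_int (lattice_det \<Lambda>))))\<^sup>2 \<and>
      (\<forall>v. first_vertex_from n p \<Lambda> x_start v \<longrightarrow> output_point s = v)"
    using ts first_vertex_from_iff[OF _ basis] asm unfolding b det l_def by blast
qed

end
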